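(* Let $G,H$ be two infinite groups, let $A,B$ be finite alphabets, and let $X\subset A^G$ be a faithful strongly irreducible $G$-subshift and $Y\subset B^H$ a faithful strongly irreducible $H$-subshift. If $\operatorname{Aut}(X)\cong\operatorname{Aut}(Y)$, then $Z(G)\cong Z(H)$. In particular, if $\min(|A|,|B|)\geq 2$ and $\operatorname{Aut}(A^G)\cong\operatorname{Aut}(B^H)$, then $Z(G)\cong Z(H)$.
   Context: For a finite alphabet $A$ and a group $G$, $A^G$ carries the prodiscrete topology and the left shift action $(gx)(h)=x(g^{-1}h)$. A $G$-subshift is a closed, shift-invariant subset $X\subset A^G$. It is faithful if the only $g\in G$ with $gx=x$ for all $x\in X$ is the identity. For finite $F\subset G$, $L_F(X)=\{x|_F : x\in X\}$. $X$ is strongly irreducible if there is a finite $K\subset G$ such that whenever $S,T\subset G$ are finite with $SK\cap T=\varnothing$, for every $p\in L_S(X)$ and $q\in L_T(X)$ there is $x\in X$ with $x|_S=p$ and $x|_T=q$. $\operatorname{Aut}(X)$ is the group of all $G$-equivariant homeomorphisms $X\to X$ under composition. $Z(\cdot)$ denotes the center. *)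

theory Defs
  imports "HOL-Analysis.Function_Topology" "HOL-Algebra.Coset" "HOL-Algebra.Bij"
begin

text \<open>
  A configuration over a group \<open>G\<close> with alphabet \<open>A\<close> is an extensional function in
  \<open>carrier G \<rightarrow>\<^sub>E A\<close>, and a pattern with support \<open>F\<close> is a function extensional on \<open>F\<close>,
  so that equality of configurations and of patterns is equality in HOL.
\<close>

definition full_shift ::
    "('g, 'r) monoid_scheme \<Rightarrow> 'a set \<Rightarrow> ('g \<Rightarrow> 'a) set" where
  "full_shift G A = (carrier G \<rightarrow>\<^sub>E A)"

definition prodiscrete ::
    "('g, 'r) monoid_scheme \<Rightarrow> 'a set \<Rightarrow> ('g \<Rightarrow> 'a) topology" where
  "prodiscrete G A = product_topology (\<lambda>_. discrete_topology A) (carrier G)"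

lemma topspace_prodiscrete: "topspace (prodiscrete G A) = full_shift G A"
  by (simp add: prodiscrete_def full_shift_def)

definition shift_action ::
    "('g, 'r) monoid_scheme \<Rightarrow> 'g \<Rightarrow> ('g \<Rightarrow> 'a) \<Rightarrow> 'g \<Rightarrow> 'a" where
  "shift_action G g x = (\<lambda>h\<in>carrier G. x (inv\<^bsub>G\<^esub> g \<otimes>\<^bsub>G\<^esub> h))"

definition subshift ::
    "('g, 'r) monoid_scheme \<Rightarrow> 'a set \<Rightarrow> ('g \<Rightarrow> 'a) set \<Rightarrow> bool" where
  "subshift G A X \<longleftrightarrow>
     closedin (prodiscrete G A) X \<and>
     (\<forall>g\<in>carrier G. shift_action G g ` X \<subseteq> X)"

definition faithful_subshift ::
    "('g, 'r) monoid_scheme \<Rightarrow> ('g \<Rightarrow> 'a) set \<Rightarrow> bool" where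
  "faithful_subshift G X \<longleftrightarrow>
     (\<forall>g\<in>carrier G. (\<forall>x\<in>X. shift_action G g x = x) \<longrightarrow> g = \<one>\<^bsub>G\<^esub>)"

definition patterns :: "'g set \<Rightarrow> ('g \<Rightarrow> 'a) set \<Rightarrow> ('g \<Rightarrow> 'a) set" where
  "patterns F X = (\<lambda>x. restrict x F) ` X"

definition strongly_irreducible ::
    "('g, 'r) monoid_scheme \<Rightarrow> ('g \<Rightarrow> 'a) set \<Rightarrow> bool" where
  "strongly_irreducible G X \<longleftrightarrow>
     (\<exists>K. finite K \<and> K \<subseteq> carrier G \<and>
        (\<forall>S T. finite S \<and> S \<subseteq> carrier G \<and> finite T \<and> T \<subseteq> carrier G \<and>
               (S <#>\<^bsub>G\<^esub> K) \<inter> T = {} \<longrightarrow>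
           (\<forall>p\<in>patterns S X. \<forall>q\<in>patterns T X.
              \<exists>x\<in>X. restrict x S = p \<and> restrict x T = q)))"

text \<open>
  As in \<^const>\<open>BijGroup\<close>, whose multiplication (composition) is reused, automorphisms are
  represented by functions extensional on \<open>X\<close>.
\<close>

definition Aut_group ::
    "('g, 'r) monoid_scheme \<Rightarrow> 'a set \<Rightarrow> ('g \<Rightarrow> 'a) set \<Rightarrow>
      (('g \<Rightarrow> 'a) \<Rightarrow> 'g \<Rightarrow> 'a) monoid" where
  "Aut_group G A X = (BijGroup X)
     \<lparr>carrier := {f \<in> Bij X.
        homeomorphic_map (subtopology (prodiscrete G A) X) (subtopology (prodiscrete G A) X) f \<and>
        (\<forall>g\<in>carrier G. \<forall>x\<in>X. f (shift_action G g x) = shift_action G g (f x))}\<rparr>"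

definition center_group ::
    "('g, 'r) monoid_scheme \<Rightarrow> ('g, 'r) monoid_scheme" where
  "center_group G = G
     \<lparr>carrier := {z \<in> carrier G. \<forall>g\<in>carrier G. z \<otimes>\<^bsub>G\<^esub> g = g \<otimes>\<^bsub>G\<^esub> z}\<rparr>"

end

theory Submission
  imports Defs
begin

text \<open>
  The proof is a form of Ryan's theorem: an automorphism \<open>f\<close> commuting with all automorphisms of a
  faithful strongly irreducible subshift \<open>X\<close> over an infinite group is the shift by a central element.
  Hence the center of \<open>Aut(X)\<close> is isomorphic to \<open>Z(G)\<close>.

  To produce enough automorphisms, fix a finite window \<open>K\<close> and a configuration \<open>x\<close> for which the number
  of admissible patterns on \<open>K\<close> is minimal; a finite part of \<open>x\<close> around \<open>K\<close> then already makes these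
  patterns freely exchangeable. Enlarge this part to a pattern \<open>T\<close> such that no window of one
  occurrence meets another occurrence. Exchanging two patterns in all windows is then an
  automorphism, and \<open>f\<close> has to preserve the presence of such markers up to a bounded displacement.
  As \<open>T\<close> may contain any prescribed pattern, \<open>f x\<close> is a translate of \<open>x\<close> outside a fixed finite set, for
  every \<open>x\<close>. Gluing shows that the translation does not depend on \<open>x\<close>, and equivariance that it is
  central and has no exceptions.
\<close>

section \<open>Separated sets in groups\<close>

text \<open>No finite-type condition is available: which patterns fit into a window may depend on
  coordinates arbitrarily far away, so exchanging two of them need not be local. Minimality of the
  number of fillings makes admissibility visible on a finite neighbourhood. The set \<open>K\<close>
  is both gluing constant and window: the points far from \<open>\<one>\<close> are those off
  \<open>K\<close>, so the symbol at \<open>\<one>\<close> can be altered while finitely many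
  coordinates off \<open>K\<close> are kept. The obstacle is a non-overlapping marker in an
  arbitrary infinite group. A translation is ruled out by two marker positions with different
  symbols, but adding such positions creates new translations to rule out. The way out is to place
  beside each new point a copy of one pattern that the core of the marker avoids, which rules out
  every translation created by the addition at once. Such a pattern exists by counting: with
  \<open>S\<close> the window, at most |S| (4 + |L|) positions have to be avoided, linear in the
  pattern length |L|; each spoils at most 2^|S| of the 2^|L| patterns on a
  \<open>K\<close>-separated \<open>L\<close>.\<close>

lemma finite_set_mult:
  "finite A \<Longrightarrow> finite B \<Longrightarrow> finite (A <#>\<^bsub>G\<^esub> B)"
  by (simp add: set_mult_def)

lemma set_multI: "a \<in> A \<Longrightarrow> b \<in> B \<Longrightarrow> a \<otimes>\<^bsub>G\<^esub> b \<in> A <#>\<^bsub>G\<^esub> B"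
  by (auto simp: set_mult_def)

context group
begin

lemma inv_mult_cancel: "x \<in> carrier G \<Longrightarrow> y \<in> carrier G \<Longrightarrow> inv x \<otimes> (x \<otimes> y) = y"
  by (metis inv_solve_left' l_inv_ex m_closed)

lemma mult_inv_cancel: "x \<in> carrier G \<Longrightarrow> y \<in> carrier G \<Longrightarrow> x \<otimes> (inv x \<otimes> y) = y"
  by (metis inv_closed inv_inv inv_mult_cancel)

lemmas group_normalize = m_assoc inv_mult_group inv_mult_cancel mult_inv_cancel

text \<open>Greedy choice: an infinite group has a point outside any finite set of forbidden ones.
  Both L Z and L Z^-1 are forbidden because \<open>Z\<close> need not be symmetric.\<close>

lemma separated_set_exists:
  assumes "infinite (carrier G)" "finite Z" "Z \<subseteq> carrier G"
  shows "\<exists>L. finite L \<and> L \<subseteq> carrier G \<and> card L = n \<and>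
    (\<forall>l\<in>L. \<forall>m\<in>L. l \<noteq> m \<longrightarrow> inv l \<otimes> m \<notin> Z)"
proof (induction n)
  case 0
  show ?case by (rule exI[of _ "{}"]) simp
next
  case (Suc n)
  then obtain L where L: "finite L" "L \<subseteq> carrier G" "card L = n"
    "\<And>l m. l \<in> L \<Longrightarrow> m \<in> L \<Longrightarrow> l \<noteq> m \<Longrightarrow> inv l \<otimes> m \<notin> Z" by metis
  have "finite (L \<union> (L <#> Z) \<union> (L <#> m_inv G ` Z))"
    using L assms by (intro finite_UnI finite_set_mult) auto
  then obtain g where g: "g \<in> carrier G" "g \<notin> L \<union> (L <#> Z) \<union> (L <#> m_inv G ` Z)"
    using assms(1) by (meson finite_subset subsetI)
  have 1: "inv l \<otimes> g \<notin> Z" if "l \<in> L" for l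
  proof
    assume "inv l \<otimes> g \<in> Z"
    then have "l \<otimes> (inv l \<otimes> g) \<in> L <#> Z" using that by (intro set_multI)
    moreover have "l \<in> carrier G" using L that by auto
    ultimately show False using g by (auto simp: mult_inv_cancel)
  qed
  have 2: "inv g \<otimes> l \<notin> Z" if "l \<in> L" for l
  proof
    assume "inv g \<otimes> l \<in> Z"
    then have "l \<otimes> inv (inv g \<otimes> l) \<in> L <#> m_inv G ` Z" using that by (intro set_multI) auto
    moreover have "l \<in> carrier G" using L that by auto
    ultimately show False using g by (auto simp: group_normalize)
  qed
  show ?case
    using L g 1 2 by (intro exI[of _ "insert g L"]) auto
qed

end

section \<open>Subshifts and local maps\<close>

locale group_subshift = group G for G (structure) +
  fixes A :: "'a set" and X :: "('g \<Rightarrow> 'a) set"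
  assumes finite_A: "finite A"
    and subshift_X: "subshift G A X"
begin

abbreviation act :: "'g \<Rightarrow> ('g \<Rightarrow> 'a) \<Rightarrow> 'g \<Rightarrow> 'a" where
  "act \<equiv> shift_action G"

lemma act_apply: "h \<in> carrier G \<Longrightarrow> act g x h = x (inv g \<otimes> h)"
  by (simp add: shift_action_def)

lemma act_mult: "g \<in> carrier G \<Longrightarrow> h \<in> carrier G \<Longrightarrow> act g x (g \<otimes> h) = x h"
  by (simp add: act_apply inv_mult_cancel)

lemma act_X: "g \<in> carrier G \<Longrightarrow> x \<in> X \<Longrightarrow> act g x \<in> X"
  using subshift_X by (auto simp: subshift_def)

lemma X_subset: "X \<subseteq> carrier G \<rightarrow>\<^sub>E A"
  using subshift_X closedin_subset by (fastforce simp: subshift_def topspace_prodiscrete full_shift_def)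

lemma X_A: "x \<in> X \<Longrightarrow> h \<in> carrier G \<Longrightarrow> x h \<in> A"
  using X_subset by auto

lemma X_eqI: "x \<in> X \<Longrightarrow> y \<in> X \<Longrightarrow> (\<And>h. h \<in> carrier G \<Longrightarrow> x h = y h) \<Longrightarrow> x = y"
  using X_subset by (meson PiE_ext subsetD)

lemma cylinder_open:
  assumes "finite F" "F \<subseteq> carrier G" "x \<in> carrier G \<rightarrow>\<^sub>E A"
  shows "openin (prodiscrete G A) {y \<in> carrier G \<rightarrow>\<^sub>E A. \<forall>h\<in>F. y h = x h}"
proof -
  have "{y \<in> carrier G \<rightarrow>\<^sub>E A. \<forall>h\<in>F. y h = x h} = (\<Pi>\<^sub>E h\<in>carrier G. if h \<in> F then {x h} else A)"
    (is "?C = ?P")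
  proof (rule subset_antisym; rule subsetI)
    fix y assume y: "y \<in> ?C"
    then show "y \<in> ?P" by (intro PiE_I) auto
  next
    fix y assume y: "y \<in> ?P"
    have "y h \<in> (if h \<in> F then {x h} else A)" if "h \<in> carrier G" for h
      using PiE_mem[OF y that] .
    moreover have "x h \<in> A" if "h \<in> carrier G" for h
      using assms(3) that by auto
    ultimately have "y h \<in> A" "h \<in> F \<Longrightarrow> y h = x h" if "h \<in> carrier G" for h
      using that by (metis singletonD)+
    then show "y \<in> ?C" using y assms(2) by (auto simp: PiE_iff)
  qed
  moreover have "finite {h \<in> carrier G. (if h \<in> F then {x h} else A) \<noteq> A}"
    by (rule finite_subset[OF _ assms(1)]) auto
  ultimately show ?thesis
    using assms by (auto simp: prodiscrete_def openin_PiE_gen)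
qed

lemma open_contains_cylinder:
  assumes "openin (prodiscrete G A) U" "x \<in> U"
  shows "\<exists>F. finite F \<and> F \<subseteq> carrier G \<and>
    (\<forall>y \<in> carrier G \<rightarrow>\<^sub>E A. (\<forall>h\<in>F. y h = x h) \<longrightarrow> y \<in> U)"
proof -
  obtain V where V: "finite {i \<in> carrier G. V i \<noteq> A}" "x \<in> Pi\<^sub>E (carrier G) V" "Pi\<^sub>E (carrier G) V \<subseteq> U"
    using assms by (auto simp: prodiscrete_def openin_product_topology_alt)
  have "y \<in> Pi\<^sub>E (carrier G) V"
    if y: "y \<in> carrier G \<rightarrow>\<^sub>E A" "\<forall>h\<in>{i \<in> carrier G. V i \<noteq> A}. y h = x h" for y
  proof (rule PiE_I)
    fix h assume "h \<in> carrier G"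
    then show "y h \<in> V h" using y PiE_mem[OF V(2)] by (cases "V h = A") auto
  qed (use y in auto)
  with V show ?thesis by (intro exI[of _ "{i \<in> carrier G. V i \<noteq> A}"] conjI ballI impI) blast+
qed

text \<open>Closedness in the form used throughout: finitely many coordinates certify that a
  configuration is not in \<open>X\<close>. This turns being a filling into a finite test and
  reduces infinite swaps to finite ones.\<close>

lemma not_in_X_witness:
  assumes "z \<in> carrier G \<rightarrow>\<^sub>E A" "z \<notin> X"
  shows "\<exists>F. finite F \<and> F \<subseteq> carrier G \<and> (\<forall>x\<in>X. \<exists>h\<in>F. x h \<noteq> z h)"
proof -
  have "openin (prodiscrete G A) (full_shift G A - X)"
    using subshift_X by (auto simp: subshift_def closedin_def topspace_prodiscrete)
  moreover have "z \<in> full_shift G A - X" using assms by (simp add: full_shift_def)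
  ultimately obtain F where "finite F" "F \<subseteq> carrier G"
    "\<And>y. y \<in> carrier G \<rightarrow>\<^sub>E A \<Longrightarrow> \<forall>h\<in>F. y h = z h \<Longrightarrow> y \<in> full_shift G A - X"
    using open_contains_cylinder by metis
  then show ?thesis using X_subset by (metis DiffD2 subsetD)
qed

lemma compact_X: "compactin (prodiscrete G A) X"
proof -
  have "compact_space (prodiscrete G A)"
    unfolding prodiscrete_def compact_space_product_topology
    using finite_A by (simp add: compact_space_discrete_topology)
  then show ?thesis
    using subshift_X by (auto simp: subshift_def intro: closedin_compact_space)
qed

section \<open>Continuity as finite dependence on coordinates\<close>

abbreviation topX :: "('g \<Rightarrow> 'a) topology" where
  "topX \<equiv> subtopology (prodiscrete G A) X"

lemma topspace_topX: "topspace topX = X"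
  using X_subset by (auto simp: topspace_prodiscrete full_shift_def)

text \<open>The compactness half of the Curtis-Hedlund-Lyndon theorem: every configuration has a
  finite set of coordinates that fixes the value of the image at \<open>h\<close>, and finitely many
  of these sets suffice for all of \<open>X\<close>.\<close>

lemma continuous_local:
  assumes f: "continuous_map topX topX f" and h: "h \<in> carrier G"
  shows "\<exists>M. finite M \<and> M \<subseteq> carrier G \<and>
    (\<forall>x\<in>X. \<forall>y\<in>X. (\<forall>m\<in>M. x m = y m) \<longrightarrow> f x h = f y h)"
proof -
  have fX: "f x \<in> X" if "x \<in> X" for x
    using f that topspace_topX by (metis continuous_map_funspace funcset_mem)
  have "\<exists>M. finite M \<and> M \<subseteq> carrier G \<and> (\<forall>y\<in>X. (\<forall>m\<in>M. y m = x m) \<longrightarrow> f y h = f x h)"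
    if x: "x \<in> X" for x
  proof -
    have "openin (prodiscrete G A) {y \<in> carrier G \<rightarrow>\<^sub>E A. \<forall>k\<in>{h}. y k = f x k}"
      using h fX[OF x] X_subset by (intro cylinder_open) auto
    then have "openin topX {y \<in> topspace topX. f y \<in> X \<inter> {y \<in> carrier G \<rightarrow>\<^sub>E A. \<forall>k\<in>{h}. y k = f x k}}"
      by (intro openin_continuous_map_preimage[OF f] openin_subtopology_Int2)
    moreover have "{y \<in> topspace topX. f y \<in> X \<inter> {y \<in> carrier G \<rightarrow>\<^sub>E A. \<forall>k\<in>{h}. y k = f x k}}
        = {y \<in> X. f y h = f x h}"
      using fX X_subset unfolding topspace_topX by blast
    ultimately have "openin topX {y \<in> X. f y h = f x h}" by simp
    then obtain U where U: "openin (prodiscrete G A) U"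
      "{y \<in> X. f y h = f x h} = U \<inter> X"
      unfolding openin_subtopology by blast
    then have "x \<in> U" using x by auto
    from open_contains_cylinder[OF U(1) this] obtain F where F: "finite F" "F \<subseteq> carrier G"
      "\<And>y. y \<in> carrier G \<rightarrow>\<^sub>E A \<Longrightarrow> \<forall>h\<in>F. y h = x h \<Longrightarrow> y \<in> U" by metis
    have "f y h = f x h" if "y \<in> X" "\<forall>m\<in>F. y m = x m" for y
    proof -
      have "y \<in> U" using that F(3) X_subset by auto
      then have "y \<in> {y \<in> X. f y h = f x h}" using U(2) that by auto
      then show ?thesis by simp
    qed
    then show ?thesis using F by metis
  qed
  then obtain M where M: "\<And>x. x \<in> X \<Longrightarrow> finite (M x)" "\<And>x. x \<in> X \<Longrightarrow> M x \<subseteq> carrier G"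
    "\<And>x y. x \<in> X \<Longrightarrow> y \<in> X \<Longrightarrow> \<forall>m\<in>M x. y m = x m \<Longrightarrow> f y h = f x h"
    by metis
  define U where "U x = {y \<in> carrier G \<rightarrow>\<^sub>E A. \<forall>m\<in>M x. y m = x m}" for x
  have "\<forall>V\<in>U ` X. openin (prodiscrete G A) V"
    unfolding U_def using M X_subset by (auto intro!: cylinder_open)
  moreover have "X \<subseteq> \<Union>(U ` X)"
    unfolding U_def using X_subset by auto
  ultimately obtain \<F> where "finite \<F>" "\<F> \<subseteq> U ` X" "X \<subseteq> \<Union>\<F>"
    using compact_X unfolding compactin_def by meson
  then obtain C where C: "finite C" "C \<subseteq> X" "X \<subseteq> \<Union>(U ` C)"
    by (metis finite_subset_image)
  show ?thesis
  proof (intro exI[of _ "\<Union>(M ` C)"] conjI ballI impI)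
    fix x y assume xy: "x \<in> X" "y \<in> X" "\<forall>m\<in>\<Union>(M ` C). x m = y m"
    then obtain c where c: "c \<in> C" "x \<in> U c" using C by auto
    then have "\<forall>m\<in>M c. x m = c m" "\<forall>m\<in>M c. y m = c m"
      using xy(3) by (auto simp: U_def)
    then show "f x h = f y h" using M(3) c C xy by (metis subsetD)
  next
    show "finite (\<Union>(M ` C))" using C M(1) by blast
    show "\<Union>(M ` C) \<subseteq> carrier G" using C M(2) by blast
  qed
qed

lemma local_continuous:
  assumes f: "\<And>x. x \<in> X \<Longrightarrow> f x \<in> X"
    and loc: "\<And>h. h \<in> carrier G \<Longrightarrow> \<exists>M. finite M \<and> M \<subseteq> carrier G \<and>
      (\<forall>x\<in>X. \<forall>y\<in>X. (\<forall>m\<in>M. x m = y m) \<longrightarrow> f x h = f y h)"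
  shows "continuous_map topX topX f"
proof -
  have "continuous_map topX (discrete_topology A) (\<lambda>x. f x h)" if h: "h \<in> carrier G" for h
  proof -
    obtain M where M: "finite M" "M \<subseteq> carrier G"
      "\<forall>x\<in>X. \<forall>y\<in>X. (\<forall>m\<in>M. x m = y m) \<longrightarrow> f x h = f y h"
      using loc[OF h] by (elim exE conjE) (rule that)
    have "openin topX {x \<in> X. f x h \<in> U}" for U
    proof (rule openin_subopen[THEN iffD2], intro ballI)
      fix x assume "x \<in> {x \<in> X. f x h \<in> U}"
      then have x: "x \<in> X" "f x h \<in> U" by auto
      then have xA: "x \<in> carrier G \<rightarrow>\<^sub>E A" using X_subset by (rule_tac subsetD)
      define C where "C = {y \<in> carrier G \<rightarrow>\<^sub>E A. \<forall>m\<in>M. y m = x m}"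
      have "openin topX (X \<inter> C)"
        unfolding C_def by (intro openin_subtopology_Int2 cylinder_open M xA)
      moreover have "x \<in> X \<inter> C" using x xA by (simp add: C_def)
      moreover have "X \<inter> C \<subseteq> {x \<in> X. f x h \<in> U}"
      proof
        fix y assume "y \<in> X \<inter> C"
        then have y: "y \<in> X" "\<forall>m\<in>M. y m = x m" by (simp_all add: C_def)
        then have "f y h = f x h" using M(3) x by blast
        then show "y \<in> {x \<in> X. f x h \<in> U}" using y x by simp
      qed
      ultimately show "\<exists>T. openin topX T \<and> x \<in> T \<and> T \<subseteq> {x \<in> X. f x h \<in> U}" by blast
    qed
    then show ?thesis
      using f h X_A unfolding continuous_map_def topspace_topX topspace_discrete_topology
      by (simp add: Pi_iff)
  qed
  moreover have "f \<in> topspace topX \<rightarrow> extensional (carrier G)"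
  proof (rule funcsetI)
    fix x assume "x \<in> topspace topX"
    then have "f x \<in> carrier G \<rightarrow>\<^sub>E A" using f X_subset by (auto simp only: topspace_topX)
    then show "f x \<in> extensional (carrier G)" by (simp add: PiE_iff)
  qed
  ultimately have "continuous_map topX (prodiscrete G A) f"
    unfolding prodiscrete_def continuous_map_componentwise by (simp add: image_subset_iff_funcset)
  then show ?thesis
    using f by (auto simp: continuous_map_in_subtopology topspace_topX)
qed

end

section \<open>Strong irreducibility\<close>

text \<open>The gluing constant is taken symmetric, so that the order of the two sets does not
  matter, and contains \<open>\<one>\<close>, so that sets far apart are disjoint. Gluing is phrased
  with configurations instead of patterns.\<close>

locale si_subshift = group_subshift G A X
    for G (structure) and A :: "'a set" and X :: "('g \<Rightarrow> 'a) set" +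
  fixes K
  assumes infinite_G: "infinite (carrier G)"
    and faithful: "\<And>g. g \<in> carrier G \<Longrightarrow> \<forall>x\<in>X. act g x = x \<Longrightarrow> g = \<one>"
    and finite_K: "finite K" and K_carrier: "K \<subseteq> carrier G" and one_K: "\<one> \<in> K"
    and inv_K: "\<And>k. k \<in> K \<Longrightarrow> inv k \<in> K"
    and glue: "\<And>S T y z. finite S \<Longrightarrow> S \<subseteq> carrier G \<Longrightarrow> finite T \<Longrightarrow> T \<subseteq> carrier G \<Longrightarrow>
      \<forall>s\<in>S. \<forall>t\<in>T. inv s \<otimes> t \<notin> K \<Longrightarrow> y \<in> X \<Longrightarrow> z \<in> X \<Longrightarrow>
      \<exists>x\<in>X. (\<forall>s\<in>S. x s = y s) \<and> (\<forall>t\<in>T. x t = z t)"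
begin

lemma inv_mult_K_sym:
  assumes "s \<in> carrier G" "t \<in> carrier G" "inv s \<otimes> t \<in> K"
  shows "inv t \<otimes> s \<in> K"
  using inv_K[OF assms(3)] assms by (simp add: inv_mult_group)

lemma glue':
  assumes "finite S" "S \<subseteq> carrier G" "finite T" "T \<subseteq> carrier G"
    and "\<And>s t. s \<in> S \<Longrightarrow> t \<in> T \<Longrightarrow> inv s \<otimes> t \<notin> K" and "y \<in> X" "z \<in> X"
  obtains x where "x \<in> X" "\<And>s. s \<in> S \<Longrightarrow> x s = y s" "\<And>t. t \<in> T \<Longrightarrow> x t = z t"
  using glue[of S T y z] assms by blast

lemma moved_point:
  assumes g: "g \<in> carrier G" "g \<noteq> \<one>"
  shows "\<exists>x\<in>X. \<exists>h\<in>carrier G. x h \<noteq> x (g \<otimes> h)"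
proof -
  obtain x where x: "x \<in> X" "act (inv g) x \<noteq> x"
    using faithful[of "inv g"] g inv_eq_1_iff by auto
  then obtain h where "h \<in> carrier G" "act (inv g) x h \<noteq> x h"
    using X_eqI act_X g by (metis inv_closed)
  then have "x h \<noteq> x (g \<otimes> h)" using g by (simp add: act_apply eq_commute)
  then show ?thesis using x \<open>h \<in> carrier G\<close> by blast
qed

text \<open>Faithfulness gives a configuration with two different symbols, and its translates show
  either of them at every position.\<close>

lemma two_letters:
  obtains a b where "a \<noteq> b"
    "\<And>h. h \<in> carrier G \<Longrightarrow> \<exists>x\<in>X. x h = a" "\<And>h. h \<in> carrier G \<Longrightarrow> \<exists>x\<in>X. x h = b"
proof -
  obtain g where g: "g \<in> carrier G" "g \<noteq> \<one>"
    using infinite_G by (metis finite.emptyI finite_insert finite_subset insertCI subsetI)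
  then obtain x k where x: "x \<in> X" "k \<in> carrier G" "x k \<noteq> x (g \<otimes> k)"
    using moved_point by blast
  have move: "\<exists>y\<in>X. y h = x m" if "h \<in> carrier G" "m \<in> carrier G" for h m
  proof
    show "act (h \<otimes> inv m) x \<in> X" using that x by (simp add: act_X)
    show "act (h \<otimes> inv m) x h = x m"
      using that by (simp add: act_apply group_normalize)
  qed
  show ?thesis using that[of "x k" "x (g \<otimes> k)"] x g move by simp
qed

text \<open>Gluing one position at a time. The resulting 2^|L| patterns are the supply for the
  counting in \<open>avoiding_pattern\<close>.\<close>

lemma free_patterns:
  assumes letters: "\<And>h. h \<in> carrier G \<Longrightarrow> \<exists>x\<in>X. x h = a" "\<And>h. h \<in> carrier G \<Longrightarrow> \<exists>x\<in>X. x h = b"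
    and L: "finite L" "L \<subseteq> carrier G" "\<And>l m. l \<in> L \<Longrightarrow> m \<in> L \<Longrightarrow> l \<noteq> m \<Longrightarrow> inv l \<otimes> m \<notin> K"
    and p: "\<And>l. l \<in> L \<Longrightarrow> p l \<in> {a, b}"
  shows "\<exists>x\<in>X. \<forall>l\<in>L. x l = p l"
  using L p
proof (induction L rule: finite_induct)
  case empty
  then show ?case using letters(1)[of \<one>] by auto
next
  case (insert l L)
  have "\<exists>x\<in>X. \<forall>l\<in>L. x l = p l"
  proof (rule insert.IH)
    show "L \<subseteq> carrier G" using insert.prems(1) by simp
    show "inv l \<otimes> m \<notin> K" if "l \<in> L" "m \<in> L" "l \<noteq> m" for l m
      using insert.prems(2)[of l m] that by simp
    show "p l \<in> {a, b}" if "l \<in> L" for l using insert.prems(3)[of l] that by simp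
  qed
  then obtain y where y: "y \<in> X" "\<forall>l\<in>L. y l = p l" by blast
  have "l \<in> carrier G" "p l = a \<or> p l = b" using insert.prems(1) insert.prems(3)[of l] by auto
  then obtain z where z: "z \<in> X" "z l = p l" using letters[of l] by metis
  obtain x where "x \<in> X" "\<And>s. s \<in> L \<Longrightarrow> x s = y s" "\<And>t. t \<in> {l} \<Longrightarrow> x t = z t"
  proof (rule glue'[of L "{l}" y z])
    show "inv s \<otimes> t \<notin> K" if "s \<in> L" "t \<in> {l}" for s t
      using insert.prems(2)[of s l] insert.hyps that by auto
  qed (use insert.hyps insert.prems(1) y z in auto)
  then show ?case using y z by (intro bexI[of _ x]) auto
qed

text \<open>If \<open>\<gamma> k\<close> is far from \<open>k\<close> for some \<open>k\<close>, the two symbols can be chosen freely; otherwise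
  \<open>k\<inverse> \<gamma> k\<close> takes one value \<open>v\<close> infinitely often, and a point moved by \<open>v\<close> can be translated away.\<close>

lemma moved_point_outside:
  assumes g: "g \<in> carrier G" "g \<noteq> \<one>" and E: "finite E"
  shows "\<exists>x\<in>X. \<exists>k\<in>carrier G. k \<notin> E \<and> g \<otimes> k \<notin> E \<and> x k \<noteq> x (g \<otimes> k)"
proof -
  \<comment> \<open>Avoiding g^-1 E as well lets one condition on k keep both k and g k out of
    \<open>E\<close>.\<close>
  define E' where "E' = E \<union> (\<lambda>e. inv g \<otimes> e) ` E"
  have finE': "finite E'" using E by (simp add: E'_def)
  have notE: "k \<notin> E \<and> g \<otimes> k \<notin> E" if "k \<in> carrier G" "k \<notin> E'" for k
    using that g by (force simp: E'_def image_iff inv_mult_cancel)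
  show ?thesis
  proof (cases "\<exists>k\<in>carrier G - E'. inv k \<otimes> (g \<otimes> k) \<notin> K")
    case True
    then obtain k where k: "k \<in> carrier G" "k \<notin> E'" "inv k \<otimes> (g \<otimes> k) \<notin> K" by auto
    obtain a b where ab: "a \<noteq> b"
      "\<And>h. h \<in> carrier G \<Longrightarrow> \<exists>x\<in>X. x h = a" "\<And>h. h \<in> carrier G \<Longrightarrow> \<exists>x\<in>X. x h = b"
      using two_letters by blast
    obtain y z where yz: "y \<in> X" "z \<in> X" "y k = a" "z (g \<otimes> k) = b"
      using ab(2)[of k] ab(3)[of "g \<otimes> k"] k g by auto
    obtain x where "x \<in> X" "\<And>s. s \<in> {k} \<Longrightarrow> x s = y s" "\<And>t. t \<in> {g \<otimes> k} \<Longrightarrow> x t = z t"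
      by (rule glue'[of "{k}" "{g \<otimes> k}" y z]) (use k g yz in auto)
    then show ?thesis using notE[OF k(1,2)] k yz ab(1) by (intro bexI[of _ x] bexI[of _ k]) auto
  next
    case False
    then have "(\<lambda>k. inv k \<otimes> (g \<otimes> k)) ` (carrier G - E') \<subseteq> K" by auto
    then have "finite ((\<lambda>k. inv k \<otimes> (g \<otimes> k)) ` (carrier G - E'))"
      using finite_K finite_subset by blast
    moreover have "infinite (carrier G - E')" using infinite_G finE' by simp
    ultimately obtain k0 where k0: "k0 \<in> carrier G - E'"
      "infinite {k \<in> carrier G - E'. inv k \<otimes> (g \<otimes> k) = inv k0 \<otimes> (g \<otimes> k0)}"
      using pigeonhole_infinite by blast
    define v where "v = inv k0 \<otimes> (g \<otimes> k0)"
    have v: "v \<in> carrier G" "v \<noteq> \<one>"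
      using g k0 by (auto simp: v_def inv_solve_left')
    obtain x h where x: "x \<in> X" "h \<in> carrier G" "x h \<noteq> x (v \<otimes> h)"
      using moved_point[OF v] by blast
    have "finite ((\<lambda>e. e \<otimes> inv h) ` E')" using finE' by simp
    then have "\<not> {k \<in> carrier G - E'. inv k \<otimes> (g \<otimes> k) = v} \<subseteq> (\<lambda>e. e \<otimes> inv h) ` E'"
      using k0(2) finite_subset unfolding v_def by blast
    then obtain k where k: "k \<in> carrier G" "inv k \<otimes> (g \<otimes> k) = v" "k \<notin> (\<lambda>e. e \<otimes> inv h) ` E'"
      by blast
    have "k \<otimes> h \<notin> E'"
    proof
      assume "k \<otimes> h \<in> E'"
      then have "k \<otimes> h \<otimes> inv h \<in> (\<lambda>e. e \<otimes> inv h) ` E'" by blast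
      then show False using k x by (simp add: m_assoc)
    qed
    \<comment> \<open>Since k v = g k, translation by k carries the pair h, v h to k h, g k
      h.\<close>
    moreover have "k \<otimes> (v \<otimes> h) = g \<otimes> (k \<otimes> h)"
      using k g x by (simp add: k(2)[symmetric] group_normalize)
    then have "act k x (g \<otimes> (k \<otimes> h)) = x (v \<otimes> h)"
      using act_mult[of k "v \<otimes> h" x] k v x by simp
    moreover have "act k x (k \<otimes> h) = x h" using act_mult k x by simp
    ultimately show ?thesis
      using notE[of "k \<otimes> h"] k x act_X by (intro bexI[of _ "act k x"] bexI[of _ "k \<otimes> h"]) auto
  qed
qed

text \<open>Each new pair is chosen off T K, so gluing it in keeps the earlier witnesses;
  \<open>T\<close> is carried through the induction to say where these lie.\<close>

lemma moved_points_outside: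
  assumes "finite \<Gamma>" "\<Gamma> \<subseteq> carrier G - {\<one>}" and E: "finite E"
  shows "\<exists>x\<in>X. \<exists>T. finite T \<and> T \<subseteq> carrier G \<and>
    (\<forall>g\<in>\<Gamma>. \<exists>k\<in>T. k \<notin> E \<and> g \<otimes> k \<in> T \<and> x k \<noteq> x (g \<otimes> k))"
  using assms(1,2)
proof (induction \<Gamma> rule: finite_induct)
  case empty
  obtain x where "x \<in> X" by (rule two_letters) (use one_closed in blast)
  then show ?case by (intro bexI[of _ x] exI[of _ "{}"]) auto
next
  case (insert g \<Gamma>)
  then obtain y T where y: "y \<in> X" and T: "finite T" "T \<subseteq> carrier G"
    and yT: "\<And>g. g \<in> \<Gamma> \<Longrightarrow> \<exists>k\<in>T. k \<notin> E \<and> g \<otimes> k \<in> T \<and> y k \<noteq> y (g \<otimes> k)" by auto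
  have g: "g \<in> carrier G" "g \<noteq> \<one>" using insert by auto
  have "finite (E \<union> (T <#> K))" using E T finite_K finite_set_mult by auto
  from moved_point_outside[OF g this] obtain z k where z: "z \<in> X" "k \<in> carrier G"
    "k \<notin> E \<union> (T <#> K)" "g \<otimes> k \<notin> E \<union> (T <#> K)" "z k \<noteq> z (g \<otimes> k)" by blast
  have far: "inv s \<otimes> t \<notin> K" if "s \<in> T" "t \<in> carrier G" "t \<notin> T <#> K" for s t
  proof
    assume "inv s \<otimes> t \<in> K"
    then have "s \<otimes> (inv s \<otimes> t) \<in> T <#> K" using that set_multI by metis
    moreover have "s \<in> carrier G" using that T by auto
    ultimately show False using that by (simp add: mult_inv_cancel)
  qed
  obtain x where x: "x \<in> X" "\<And>s. s \<in> T \<Longrightarrow> x s = y s" "\<And>t. t \<in> {k, g \<otimes> k} \<Longrightarrow> x t = z t"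
  proof (rule glue'[of T "{k, g \<otimes> k}" y z])
    show "inv s \<otimes> t \<notin> K" if "s \<in> T" "t \<in> {k, g \<otimes> k}" for s t
      using far[of s t] that z g by auto
  qed (use T z y g in auto)
  define T' where "T' = T \<union> {k, g \<otimes> k}"
  have "\<exists>j\<in>T'. j \<notin> E \<and> g' \<otimes> j \<in> T' \<and> x j \<noteq> x (g' \<otimes> j)"
    if g': "g' \<in> insert g \<Gamma>" for g'
  proof (cases "g' = g")
    case True
    then show ?thesis using x z by (intro bexI[of _ k]) (auto simp: T'_def)
  next
    case False
    then obtain j where "j \<in> T" "j \<notin> E" "g' \<otimes> j \<in> T" "y j \<noteq> y (g' \<otimes> j)" using yT g' by blast
    then show ?thesis using x by (intro bexI[of _ j]) (auto simp: T'_def)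
  qed
  then have "\<forall>g'\<in>insert g \<Gamma>. \<exists>j\<in>T'. j \<notin> E \<and> g' \<otimes> j \<in> T' \<and> x j \<noteq> x (g' \<otimes> j)"
    by (rule ballI)
  moreover have "finite T'" "T' \<subseteq> carrier G"
    using T z g by (auto simp: T'_def)
  ultimately show ?case
    using x(1) by (intro bexI[of _ x] exI[of _ T'] conjI)
qed

end

section \<open>Avoiding patterns and exchangeable fillings\<close>

lemma card_set_mult_le:
  assumes "finite A" "finite B"
  shows "card (A <#>\<^bsub>G\<^esub> B) \<le> card A * card B"
proof -
  have "A <#>\<^bsub>G\<^esub> B = (\<lambda>(a, b). a \<otimes>\<^bsub>G\<^esub> b) ` (A \<times> B)"
    by (auto simp: set_mult_def)
  then show ?thesis
    using card_image_le[of "A \<times> B"] assms by (simp add: card_cartesian_product)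
qed

text \<open>Balances the positions to be avoided, linear in the pattern length, against the
  exponential number of patterns.\<close>

lemma power_dominates_linear: "\<exists>n. c * (4 + n) < 2 ^ (n::nat)"
proof -
  \<comment> \<open>With n = 2m this makes m^2 = 2cm + 8c + 16 exceed c (4 + 2m), and 2^n is the
    square of 2^m > m.\<close>
  define m where "m = 2 * c + 4"
  have "c * (4 + 2 * m) = 2 * c * m + 4 * c" by (simp add: algebra_simps)
  also have "\<dots> < m * m"
    by (simp add: m_def algebra_simps)
  also have "\<dots> < 2 ^ m * 2 ^ m"
    using less_exp[of m] by (intro mult_strict_mono) (auto simp: m_def)
  finally have "c * (4 + 2 * m) < 2 ^ (2 * m)" by (simp only: mult_2 power_add)
  then show ?thesis ..
qed

context group
begin

text \<open>Union bound. A pattern matching \<open>x\<close> along \<open>h\<close> off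
  \<open>S\<close> is determined by its values where \<open>h\<close> leads into \<open>S\<close>,
  at most |S| positions, so each \<open>h\<close> spoils at most 2^|S| patterns. Positions in
  \<open>S\<close> do not count because a mismatch may not use the window.\<close>

lemma avoiding_pattern:
  assumes L: "finite L" "L \<subseteq> carrier G" and S: "finite S"
    and P: "finite P" "P \<subseteq> carrier G" and "a \<noteq> b"
    and small: "card P * 2 ^ card S < (2::nat) ^ card L"
  shows "\<exists>p. (\<forall>l\<in>L. p l \<in> {a, b}) \<and> (\<forall>h\<in>P. \<exists>l\<in>L. h \<otimes> l \<notin> S \<and> p l \<noteq> x (h \<otimes> l))"
proof (rule ccontr)
  define bad where "bad h = {p \<in> L \<rightarrow>\<^sub>E {a, b}. \<forall>l\<in>L. h \<otimes> l \<notin> S \<longrightarrow> p l = x (h \<otimes> l)}" for h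
  assume "\<not> ?thesis"
  then have "L \<rightarrow>\<^sub>E {a, b} \<subseteq> (\<Union>h\<in>P. bad h)"
    unfolding bad_def by (fastforce simp: PiE_iff)
  moreover have fin: "finite (L \<rightarrow>\<^sub>E {a, b})" using L by (simp add: finite_PiE)
  then have finbad: "finite (bad h)" for h unfolding bad_def by simp
  ultimately have "card (L \<rightarrow>\<^sub>E {a, b}) \<le> card (\<Union>h\<in>P. bad h)"
    using P by (intro card_mono) auto
  also have "\<dots> \<le> (\<Sum>h\<in>P. card (bad h))" using P by (intro card_UN_le)
  also have "\<dots> \<le> (\<Sum>h\<in>P. 2 ^ card S)"
  proof (rule sum_mono)
    fix h assume "h \<in> P"
    then have h: "h \<in> carrier G" using P by auto
    define M where "M = {l \<in> L. h \<otimes> l \<in> S}"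
    have "inj_on (\<lambda>p. restrict p M) (bad h)"
    proof (rule inj_onI)
      fix p q assume p: "p \<in> bad h" and q: "q \<in> bad h" and eq: "restrict p M = restrict q M"
      show "p = q"
      proof (rule PiE_ext)
        show "p \<in> L \<rightarrow>\<^sub>E {a, b}" "q \<in> L \<rightarrow>\<^sub>E {a, b}" using p q by (auto simp: bad_def)
        fix l assume l: "l \<in> L"
        show "p l = q l"
        proof (cases "l \<in> M")
          case True
          then show ?thesis using fun_cong[OF eq, of l] by simp
        next
          case False
          then show ?thesis using p q l by (simp add: bad_def M_def)
        qed
      qed
    qed
    moreover have "(\<lambda>p. restrict p M) ` bad h \<subseteq> M \<rightarrow>\<^sub>E {a, b}"
      unfolding image_subset_iff restrict_PiE_iff by (auto simp: bad_def M_def dest: PiE_mem)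
    ultimately have "card (bad h) \<le> card (M \<rightarrow>\<^sub>E {a, b})"
      using L by (intro card_inj_on_le) (auto simp: M_def finite_PiE)
    also have "\<dots> = 2 ^ card M" using L \<open>a \<noteq> b\<close> by (simp add: card_PiE M_def flip: numeral_2_eq_2)
    also have "card M \<le> card S"
    proof (rule card_inj_on_le[of "\<lambda>l. h \<otimes> l"])
      show "inj_on (\<lambda>l. h \<otimes> l) M" using L h by (intro inj_onI) (auto simp: M_def subset_iff)
      show "(\<lambda>l. h \<otimes> l) ` M \<subseteq> S" by (auto simp: M_def)
    qed (use S in auto)
    then have "(2::nat) ^ card M \<le> 2 ^ card S" by simp
    finally show "card (bad h) \<le> 2 ^ card S" .
  qed
  finally show False using small L \<open>a \<noteq> b\<close> by (simp add: card_PiE flip: numeral_2_eq_2)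
qed

text \<open>Two translates \<open>n L\<close>, \<open>n' L\<close> close to the same \<open>Y\<close> would give \<open>n\<inverse> n' \<in> Z\<close>, so every
  \<open>Y\<close> excludes at most one element of \<open>N\<close>.\<close>

lemma far_translate_exists:
  fixes Z L K U
  defines "Z \<equiv> (L <#> K <#> U <#> m_inv G ` K <#> m_inv G ` L)"
  assumes L: "L \<subseteq> carrier G" and K: "K \<subseteq> carrier G"
    and N: "N \<subseteq> carrier G" "\<And>n m. n \<in> N \<Longrightarrow> m \<in> N \<Longrightarrow> n \<noteq> m \<Longrightarrow> inv n \<otimes> m \<notin> Z"
    and k: "k \<in> carrier G"
    and Y: "finite \<Y>" "card \<Y> < card N"
      "\<And>Y. Y \<in> \<Y> \<Longrightarrow> Y \<subseteq> carrier G"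
      "\<And>Y y z. Y \<in> \<Y> \<Longrightarrow> y \<in> Y \<Longrightarrow> z \<in> Y \<Longrightarrow> inv y \<otimes> z \<in> U"
  shows "\<exists>n\<in>N. \<forall>Y\<in>\<Y>. \<forall>y\<in>Y. \<forall>l\<in>L. inv (k \<otimes> n \<otimes> l) \<otimes> y \<notin> K"
proof (rule ccontr)
  assume "\<not> ?thesis"
  then have "\<forall>n\<in>N. \<exists>Y. Y \<in> \<Y> \<and> (\<exists>y\<in>Y. \<exists>l\<in>L. inv (k \<otimes> n \<otimes> l) \<otimes> y \<in> K)" by blast
  then obtain c where c: "\<And>n. n \<in> N \<Longrightarrow> c n \<in> \<Y>"
    "\<And>n. n \<in> N \<Longrightarrow> \<exists>y\<in>c n. \<exists>l\<in>L. inv (k \<otimes> n \<otimes> l) \<otimes> y \<in> K" by metis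
  have "inj_on c N"
  proof (rule inj_onI, rule ccontr)
    fix n m assume nm: "n \<in> N" "m \<in> N" "c n = c m" "n \<noteq> m"
    obtain y l where y: "y \<in> c n" "l \<in> L" "inv (k \<otimes> n \<otimes> l) \<otimes> y \<in> K" using c nm by blast
    obtain z j where z: "z \<in> c m" "j \<in> L" "inv (k \<otimes> m \<otimes> j) \<otimes> z \<in> K" using c nm by blast
    have G: "n \<in> carrier G" "m \<in> carrier G" "y \<in> carrier G" "z \<in> carrier G" "l \<in> carrier G" "j \<in> carrier G"
      using nm y z c Y(3) L N by blast+
    have "inv y \<otimes> z \<in> U" using Y(4) c nm y z by metis
    \<comment> \<open>Telescoping product with one factor from each set in \<open>Z\<close>: y, z,
      l, j and k all cancel and n^-1 m remains.\<close>
    then have "l \<otimes> (inv (k \<otimes> n \<otimes> l) \<otimes> y) \<otimes> (inv y \<otimes> z) \<otimes> inv (inv (k \<otimes> m \<otimes> j) \<otimes> z) \<otimes> inv j \<in> Z"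
      unfolding Z_def using y z by (intro set_multI imageI)
    also have "l \<otimes> (inv (k \<otimes> n \<otimes> l) \<otimes> y) \<otimes> (inv y \<otimes> z) \<otimes> inv (inv (k \<otimes> m \<otimes> j) \<otimes> z) \<otimes> inv j = inv n \<otimes> m"
      using G k by (simp add: group_normalize)
    finally show False using N(2) nm by blast
  qed
  then have "card N \<le> card \<Y>"
    using c Y(1) by (intro card_inj_on_le[of c]) auto
  then show False using Y(2) by simp
qed

end

section \<open>Fillings of the window\<close>

context si_subshift
begin

text \<open>The analogue of a follower set: it depends on \<open>y\<close> only off
  \<open>K\<close>. Extensional patterns keep it finite.\<close>

definition fillings :: "('g \<Rightarrow> 'a) \<Rightarrow> ('g \<Rightarrow> 'a) set" where
  "fillings y = {u \<in> K \<rightarrow>\<^sub>E A. override_on y u K \<in> X}"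

lemma finite_fillings: "finite (fillings y)"
  by (simp add: fillings_def finite_PiE finite_K finite_A)

lemma restrict_fillings:
  assumes y: "y \<in> X"
  shows "restrict y K \<in> fillings y"
proof -
  have "override_on y (restrict y K) K = y" by (auto simp: override_on_def)
  moreover have "restrict y K \<in> K \<rightarrow>\<^sub>E A" using X_A[OF y] K_carrier by auto
  ultimately show ?thesis using y by (simp add: fillings_def)
qed

lemma override_in_full:
  assumes "y \<in> X" "u \<in> K \<rightarrow>\<^sub>E A"
  shows "override_on y u K \<in> carrier G \<rightarrow>\<^sub>E A"
proof (rule PiE_I)
  show "override_on y u K h \<in> A" if "h \<in> carrier G" for h
    using X_A[OF assms(1) that] assms(2) by (cases "h \<in> K") (auto simp: override_on_def)
  show "override_on y u K h = undefined" if "h \<notin> carrier G" for h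
    using that K_carrier X_subset assms(1) PiE_arb[of y "carrier G" "\<lambda>_. A" h]
    by (auto simp: override_on_def)
qed

lemma not_filling_witness:
  assumes "y \<in> X" "u \<in> K \<rightarrow>\<^sub>E A" "u \<notin> fillings y"
  shows "\<exists>F. finite F \<and> F \<subseteq> carrier G \<and> (\<forall>x\<in>X. \<exists>h\<in>F. x h \<noteq> override_on y u K h)"
  using not_in_X_witness[OF override_in_full] assms by (simp add: fillings_def)

text \<open>The symbol at \<open>\<one>\<close> can be changed against any finite part of \<open>y\<close> outside \<open>K\<close>; a finite part
  suffices because \<open>X\<close> is closed and there are only finitely many candidates on \<open>K\<close>.\<close>

lemma other_filling:
  assumes y: "y \<in> X"
  shows "\<exists>u\<in>fillings y. u \<one> \<noteq> y \<one>"
proof (rule ccontr)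
  assume none: "\<not> ?thesis"
  obtain a b where ab: "a \<noteq> b"
    "\<And>h. h \<in> carrier G \<Longrightarrow> \<exists>x\<in>X. x h = a" "\<And>h. h \<in> carrier G \<Longrightarrow> \<exists>x\<in>X. x h = b"
    by (rule two_letters) (rule that)
  then obtain z where z: "z \<in> X" "z \<one> \<noteq> y \<one>" by (metis one_closed)
  define D where "D = (K \<rightarrow>\<^sub>E A) - fillings y"
  have "\<forall>u\<in>D. \<exists>F. finite F \<and> F \<subseteq> carrier G \<and> (\<forall>x\<in>X. \<exists>h\<in>F. x h \<noteq> override_on y u K h)"
    using not_filling_witness[OF y] by (simp add: D_def)
  then obtain F where F: "\<And>u. u \<in> D \<Longrightarrow> finite (F u)" "\<And>u. u \<in> D \<Longrightarrow> F u \<subseteq> carrier G"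
    "\<And>u x. u \<in> D \<Longrightarrow> x \<in> X \<Longrightarrow> \<exists>h\<in>F u. x h \<noteq> override_on y u K h" by metis
  have finD: "finite D" by (simp add: D_def finite_PiE finite_K finite_A)
  \<comment> \<open>As \<open>inv \<one> \<otimes> t\<close> is t, the points far from
    \<open>\<one>\<close> are exactly those off \<open>K\<close>; this is why the gluing constant
    can serve as the window.\<close>
  obtain x where x: "x \<in> X" "\<And>s. s \<in> {\<one>} \<Longrightarrow> x s = z s" "\<And>t. t \<in> \<Union>(F ` D) - K \<Longrightarrow> x t = y t"
  proof (rule glue'[of "{\<one>}" "\<Union>(F ` D) - K" z y])
    show "inv s \<otimes> t \<notin> K" if "s \<in> {\<one>}" "t \<in> \<Union>(F ` D) - K" for s t
    proof -
      have "t \<in> carrier G" using that F(2) by blast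
      then show ?thesis using that by simp
    qed
    show "finite (\<Union>(F ` D) - K)" using finD F(1) by simp
    show "\<Union>(F ` D) - K \<subseteq> carrier G" using F(2) by blast
  qed (use y z in auto)
  have u: "restrict x K \<in> K \<rightarrow>\<^sub>E A" using X_A[OF x(1)] K_carrier by auto
  have "restrict x K \<one> \<noteq> y \<one>" using x(2) z one_K by simp
  then have "restrict x K \<in> D" using none u by (auto simp: D_def)
  from F(3)[OF this x(1)] x(3) \<open>restrict x K \<in> D\<close> show False
    by (auto simp: override_on_def split: if_splits)
qed

text \<open>Choose \<open>x\<close> with as few fillings as possible. Each pattern that is not a filling is excluded
  by a finite part of \<open>x\<close>, so nearby configurations have no more fillings, and by minimality the same.\<close>

lemma stable_fillings:
  assumes x0: "x0 \<in> X" and F0: "finite F0" "F0 \<subseteq> carrier G"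
  obtains x F where "x \<in> X" "finite F" "F \<subseteq> carrier G" "F0 \<subseteq> F" "K \<subseteq> F"
    "\<And>h. h \<in> F0 - K \<Longrightarrow> x h = x0 h"
    "\<And>y. y \<in> X \<Longrightarrow> (\<And>h. h \<in> F - K \<Longrightarrow> y h = x h) \<Longrightarrow> fillings y = fillings x"
proof -
  \<comment> \<open>Competitors agree with \<open>x0\<close> only off \<open>K\<close>, so that any
    \<open>y\<close> agreeing with the minimizer on \<open>E - K\<close> is one of them.\<close>
  obtain x where x: "x \<in> X \<and> (\<forall>h\<in>F0 - K. x h = x0 h)"
    and least: "\<And>y. y \<in> X \<and> (\<forall>h\<in>F0 - K. y h = x0 h) \<Longrightarrow> card (fillings x) \<le> card (fillings y)"
    using ex_has_least_nat[of "\<lambda>x. x \<in> X \<and> (\<forall>h\<in>F0 - K. x h = x0 h)" x0 "\<lambda>x. card (fillings x)"] x0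
    by blast
  define D where "D = (K \<rightarrow>\<^sub>E A) - fillings x"
  have "\<forall>u\<in>D. \<exists>F. finite F \<and> F \<subseteq> carrier G \<and> (\<forall>y\<in>X. \<exists>h\<in>F. y h \<noteq> override_on x u K h)"
    using not_filling_witness x by (simp add: D_def)
  then obtain F where F: "\<And>u. u \<in> D \<Longrightarrow> finite (F u)" "\<And>u. u \<in> D \<Longrightarrow> F u \<subseteq> carrier G"
    "\<And>u y. u \<in> D \<Longrightarrow> y \<in> X \<Longrightarrow> \<exists>h\<in>F u. y h \<noteq> override_on x u K h" by metis
  have finD: "finite D" by (simp add: D_def finite_PiE finite_K finite_A)
  define E where "E = F0 \<union> K \<union> \<Union>(F ` D)"
  have same: "fillings y = fillings x" if y: "y \<in> X" "\<And>h. h \<in> E - K \<Longrightarrow> y h = x h" for y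
  proof (rule card_seteq)
    show "fillings y \<subseteq> fillings x"
    proof (rule subsetI, rule ccontr)
      fix u assume u: "u \<in> fillings y" "u \<notin> fillings x"
      then have "u \<in> D" "override_on y u K \<in> X" by (auto simp: D_def fillings_def)
      from F(3)[OF this] y(2) \<open>u \<in> D\<close> show False
        by (auto simp: override_on_def E_def split: if_splits)
    qed
    show "card (fillings x) \<le> card (fillings y)"
      using least y x by (simp add: E_def)
  qed (rule finite_fillings)
  show ?thesis
  proof (rule that[of x E])
    show "finite E" using F0 finite_K finD F(1) by (simp add: E_def)
    show "E \<subseteq> carrier G" using F0 K_carrier F(2) by (auto simp: E_def)
    show "F0 \<subseteq> E" "K \<subseteq> E" by (auto simp: E_def)
    show "x \<in> X" "\<And>h. h \<in> F0 - K \<Longrightarrow> x h = x0 h" using x by simp_all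
  qed (rule same)
qed

end

section \<open>Markers\<close>

lemma (in group) far_translate:
  assumes "T \<subseteq> carrier G" "B \<subseteq> carrier G" "t \<in> T" "b \<in> B" "r \<in> carrier G"
    and "r \<notin> T <#> K <#> m_inv G ` B"
  shows "inv t \<otimes> (r \<otimes> b) \<notin> K"
proof
  assume "inv t \<otimes> (r \<otimes> b) \<in> K"
  then have "t \<otimes> (inv t \<otimes> (r \<otimes> b)) \<otimes> inv b \<in> T <#> K <#> m_inv G ` B"
    using assms by (intro set_multI imageI)
  moreover have "t \<in> carrier G" "b \<in> carrier G" using assms by blast+
  ultimately show False using assms by (simp add: group_normalize)
qed

context si_subshift
begin

text \<open>An obstruction to self-overlap: the marker and its translate by \<open>g\<close> cannot
  both occur. Both positions stay off \<open>S\<close> because the content of the window is going to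
  be exchanged.\<close>

definition mismatch :: "'g set \<Rightarrow> ('g \<Rightarrow> 'a) \<Rightarrow> 'g set \<Rightarrow> 'g \<Rightarrow> bool" where
  "mismatch S x T g \<longleftrightarrow> (\<exists>j\<in>T - S. g \<otimes> j \<in> T - S \<and> x (g \<otimes> j) \<noteq> x j)"

lemma mismatch_mono:
  assumes "mismatch S x T g" "T \<subseteq> T'" "\<And>t. t \<in> T \<Longrightarrow> x' t = x t"
  shows "mismatch S x' T' g"
  using assms unfolding mismatch_def by (metis DiffD1 DiffD2 DiffI subsetD)

text \<open>New points of \<open>T'\<close> are \<open>k\<close> and \<open>g k\<close>, which carry distinct symbols, and copies of the pattern
  \<open>xp\<close> on \<open>L\<close> near both of them. A translate of the marker having a window at a new point would see
  one of these copies at a position of \<open>P\<close>, where \<open>x\<close> avoids the pattern \<open>xp\<close>.\<close>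

lemma marker_step:
  assumes x: "x \<in> X" and T: "finite T" "T \<subseteq> carrier G" "S \<subseteq> T" "P <#> L \<subseteq> T"
    and L: "finite L" "L \<subseteq> carrier G" and xp: "xp \<in> X"
    and P: "P \<subseteq> carrier G" "S <#> N \<subseteq> P" "S <#> m_inv G ` L \<subseteq> P"
    and avoid: "\<And>h. h \<in> P \<Longrightarrow> \<exists>l\<in>L. h \<otimes> l \<notin> S \<and> xp l \<noteq> x (h \<otimes> l)"
    and N: "finite N" "N \<subseteq> carrier G" "card N = 4"
      "\<And>n m. n \<in> N \<Longrightarrow> m \<in> N \<Longrightarrow> n \<noteq> m \<Longrightarrow>
        inv n \<otimes> m \<notin> L <#> K <#> insert \<one> (m_inv G ` L <#> L) <#> m_inv G ` K <#> m_inv G ` L"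
    and g: "g \<in> carrier G" "g \<noteq> \<one>"
  shows "\<exists>x'\<in>X. \<exists>T'. finite T' \<and> T \<subseteq> T' \<and> T' \<subseteq> carrier G \<and> (\<forall>t\<in>T. x' t = x t) \<and>
    mismatch S x' T' g \<and> (\<forall>\<gamma>\<in>carrier G. \<forall>s\<in>S. \<gamma> \<otimes> s \<in> T' - T \<longrightarrow> mismatch S x' T' \<gamma>)"
proof -
  \<comment> \<open>The element \<open>\<one>\<close> stands for the new points and
    \<open>N <#> L\<close> for all candidate copies beside them, so the choice of \<open>k\<close>
    and \<open>k'\<close> keeps every candidate far from \<open>T\<close> before one is
    selected.\<close>
  define B where "B = insert \<one> (N <#> L)"
  define E where "E = T <#> K <#> m_inv G ` B"
  have NLG: "N <#> L \<subseteq> carrier G" using N L by (simp add: set_mult_closed)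
  have BG: "B \<subseteq> carrier G" using NLG by (simp add: B_def)
  have "finite B" using N L by (simp add: B_def finite_set_mult)
  then have finE: "finite E" using T finite_K by (simp add: E_def finite_set_mult)
  obtain z k where z: "z \<in> X" and k: "k \<in> carrier G" "k \<notin> E" "g \<otimes> k \<notin> E" and zk: "z k \<noteq> z (g \<otimes> k)"
    using moved_point_outside[OF g finE] by blast
  define k' where "k' = g \<otimes> k"
  have k': "k' \<in> carrier G" "k' \<notin> E" using k g by (simp_all add: k'_def)
  have kk': "k \<in> carrier G" "k' \<in> carrier G" by fact+
  have far: "inv t \<otimes> (r \<otimes> b) \<notin> K" if "t \<in> T" "b \<in> B" "r = k \<or> r = k'" for t b r
    using far_translate[OF T(2) BG, of t b r K] that k k' by (auto simp: E_def)
  have far1: "inv t \<otimes> r \<notin> K" if "t \<in> T" "r = k \<or> r = k'" for t r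
    using far[of t \<one> r] that kk' by (auto simp: B_def)
  have farL: "inv t \<otimes> (r \<otimes> n \<otimes> l) \<notin> K" if "t \<in> T" "n \<in> N" "l \<in> L" "r = k \<or> r = k'" for t n l r
  proof -
    have "n \<otimes> l \<in> B" using that by (simp add: B_def set_multI)
    moreover have "n \<in> carrier G" "l \<in> carrier G" using that N L by blast+
    ultimately show ?thesis using far[of t "n \<otimes> l" r] that kk' by (auto simp: m_assoc)
  qed
  \<comment> \<open>Bounds the quotients within each set to be avoided: \<open>\<one>\<close> for
    singletons, L^-1 L for the first copy \<open>M\<close>, whose common left factor k n
    cancels.\<close>
  define U where "U = insert \<one> (m_inv G ` L <#> L)"
  have "\<exists>n\<in>N. \<forall>Y\<in>{{k}, {k'}}. \<forall>y\<in>Y. \<forall>l\<in>L. inv (k \<otimes> n \<otimes> l) \<otimes> y \<notin> K"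
  proof (rule far_translate_exists[OF L(2) K_carrier N(2), where U = U])
    show "card {{k}, {k'}} < card N" using N(3) card_insert_le_m1[of 2 "{{k'}}" "{k}"] by simp
    show "Y \<subseteq> carrier G" if "Y \<in> {{k}, {k'}}" for Y using that kk' by auto
    show "inv y \<otimes> z \<in> U" if "Y \<in> {{k}, {k'}}" "y \<in> Y" "z \<in> Y" for Y y z
      using that kk' by (auto simp: U_def)
    show "inv n \<otimes> m \<notin> L <#> K <#> U <#> m_inv G ` K <#> m_inv G ` L"
      if "n \<in> N" "m \<in> N" "n \<noteq> m" for n m
      using N(4) that unfolding U_def by blast
  qed (use kk' in auto)
  then obtain n where n: "n \<in> N" "\<And>l. l \<in> L \<Longrightarrow> inv (k \<otimes> n \<otimes> l) \<otimes> k \<notin> K"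
    "\<And>l. l \<in> L \<Longrightarrow> inv (k \<otimes> n \<otimes> l) \<otimes> k' \<notin> K" by blast
  define M where "M = (\<lambda>l. k \<otimes> n \<otimes> l) ` L"
  have nG: "n \<in> carrier G" using n N by blast
  have MG: "M \<subseteq> carrier G" using L kk' nG by (auto simp: M_def)
  have MU: "inv y \<otimes> z \<in> U" if "y \<in> M" "z \<in> M" for y z
  proof -
    obtain l j where l: "l \<in> L" "j \<in> L" "y = k \<otimes> n \<otimes> l" "z = k \<otimes> n \<otimes> j" using \<open>y \<in> M\<close> \<open>z \<in> M\<close> by (auto simp: M_def)
    then have "l \<in> carrier G" "j \<in> carrier G" using L by blast+
    then have "inv y \<otimes> z = inv l \<otimes> j" using l kk' nG by (simp add: group_normalize)
    moreover have "inv l \<otimes> j \<in> m_inv G ` L <#> L" using l by (intro set_multI imageI)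
    ultimately show ?thesis by (simp add: U_def)
  qed
  have "\<exists>n\<in>N. \<forall>Y\<in>{{k}, {k'}, M}. \<forall>y\<in>Y. \<forall>l\<in>L. inv (k' \<otimes> n \<otimes> l) \<otimes> y \<notin> K"
  proof (rule far_translate_exists[OF L(2) K_carrier N(2), where U = U])
    \<comment> \<open>The second copy has three sets to avoid, so four candidates leave a free one;
      this is the origin of the size 4 of \<open>N\<close>.\<close>
    have "card {{k}, {k'}, M} \<le> 3" by (metis card_length length_Cons list.size(3) numeral_3_eq_3 list.simps(15) empty_set)
    then show "card {{k}, {k'}, M} < card N" using N(3) by simp
    show "Y \<subseteq> carrier G" if "Y \<in> {{k}, {k'}, M}" for Y using that kk' MG by auto
    show "inv y \<otimes> z \<in> U" if "Y \<in> {{k}, {k'}, M}" "y \<in> Y" "z \<in> Y" for Y y z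
      using that MU kk' by (auto simp: U_def)
    show "inv n \<otimes> m \<notin> L <#> K <#> U <#> m_inv G ` K <#> m_inv G ` L"
      if "n \<in> N" "m \<in> N" "n \<noteq> m" for n m
      using N(4) that unfolding U_def by blast
  qed (use kk' in auto)
  then obtain n' where n': "n' \<in> N" "\<And>l. l \<in> L \<Longrightarrow> inv (k' \<otimes> n' \<otimes> l) \<otimes> k \<notin> K"
    "\<And>l. l \<in> L \<Longrightarrow> inv (k' \<otimes> n' \<otimes> l) \<otimes> k' \<notin> K"
    "\<And>l y. l \<in> L \<Longrightarrow> y \<in> M \<Longrightarrow> inv (k' \<otimes> n' \<otimes> l) \<otimes> y \<notin> K" by blast
  define M' where "M' = (\<lambda>l. k' \<otimes> n' \<otimes> l) ` L"
  have n'G: "n' \<in> carrier G" using n' N by blast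
  have M'G: "M' \<subseteq> carrier G" using L kk' n'G by (auto simp: M'_def)
  have finM: "finite M" "finite M'" using L by (simp_all add: M_def M'_def)
  \<comment> \<open>Three gluings: the two new points, the copy beside \<open>k\<close>, the copy
    beside \<open>k'\<close>, each far from everything placed before.\<close>
  obtain x1 where x1: "x1 \<in> X" "\<And>s. s \<in> T \<Longrightarrow> x1 s = x s" "\<And>t. t \<in> {k, k'} \<Longrightarrow> x1 t = z t"
  proof (rule glue'[of T "{k, k'}" x z])
    show "inv s \<otimes> t \<notin> K" if "s \<in> T" "t \<in> {k, k'}" for s t using far1[of s t] that by blast
  qed (use T x z kk' in auto)
  obtain x2 where x2: "x2 \<in> X" "\<And>s. s \<in> T \<union> {k, k'} \<Longrightarrow> x2 s = x1 s"
    "\<And>t. t \<in> M \<Longrightarrow> x2 t = act (k \<otimes> n) xp t"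
  proof (rule glue'[of "T \<union> {k, k'}" M x1 "act (k \<otimes> n) xp"])
    show "inv s \<otimes> t \<notin> K" if st: "s \<in> T \<union> {k, k'}" "t \<in> M" for s t
    proof -
      obtain l where l: "l \<in> L" "t = k \<otimes> n \<otimes> l" using st by (auto simp: M_def)
      have tG: "t \<in> carrier G" using st MG by blast
      show ?thesis
      proof (cases "s \<in> T")
        case True
        then show ?thesis using farL[of s n l k] n l by blast
      next
        case False
        then have "inv t \<otimes> s \<notin> K" "s \<in> carrier G" using st n(2,3)[OF l(1)] l kk' by auto
        then show ?thesis using inv_mult_K_sym[of s t] tG by blast
      qed
    qed
  qed (use T x1 kk' MG finM xp nG act_X in auto)
  obtain x3 where x3: "x3 \<in> X" "\<And>s. s \<in> T \<union> {k, k'} \<union> M \<Longrightarrow> x3 s = x2 s"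
    "\<And>t. t \<in> M' \<Longrightarrow> x3 t = act (k' \<otimes> n') xp t"
  proof (rule glue'[of "T \<union> {k, k'} \<union> M" M' x2 "act (k' \<otimes> n') xp"])
    show "inv s \<otimes> t \<notin> K" if st: "s \<in> T \<union> {k, k'} \<union> M" "t \<in> M'" for s t
    proof -
      obtain l where l: "l \<in> L" "t = k' \<otimes> n' \<otimes> l" using st by (auto simp: M'_def)
      have tG: "t \<in> carrier G" using st M'G by blast
      show ?thesis
      proof (cases "s \<in> T")
        case True
        then show ?thesis using farL[of s n' l k'] n' l by blast
      next
        case False
        then have "inv t \<otimes> s \<notin> K" using st n'(2,3)[OF l(1)] n'(4)[OF l(1), of s] l by auto
        moreover have "s \<in> carrier G" using False st kk' MG by auto
        ultimately show ?thesis using inv_mult_K_sym[of s t] tG by blast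
      qed
    qed
  qed (use T x2 kk' MG M'G finM xp n'G act_X in auto)
  define T' where "T' = T \<union> {k, k'} \<union> M \<union> M'"
  have x3T: "x3 t = x t" if "t \<in> T" for t using x1 x2 x3 that by simp
  have not_in_T: "t \<notin> T" if "\<And>s. s \<in> T \<Longrightarrow> inv s \<otimes> t \<notin> K" for t
    using that[of t] one_K T(2) by (metis l_inv subsetD)
  have "k \<notin> T" "k' \<notin> T" using not_in_T far1 by blast+
  moreover have "M \<inter> T = {}" "M' \<inter> T = {}"
    using not_in_T farL n n' unfolding M_def M'_def by blast+
  ultimately have off: "T' - T = {k, k'} \<union> M \<union> M'" unfolding T'_def by blast
  have block: "mismatch S x3 T' \<gamma>"
    if h: "h \<in> P" "\<gamma> \<in> carrier G" and m: "m = k \<otimes> n \<or> m = k' \<otimes> n'" "\<gamma> \<otimes> h = m" for h \<gamma> m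
  proof -
    obtain l where l: "l \<in> L" "h \<otimes> l \<notin> S" "xp l \<noteq> x (h \<otimes> l)" using avoid h by blast
    have G: "h \<in> carrier G" "l \<in> carrier G" "m \<in> carrier G" using P L h l m kk' nG n'G by auto
    have hl: "h \<otimes> l \<in> T" using set_multI[OF h(1) l(1), of G] T by blast
    have gm: "\<gamma> \<otimes> (h \<otimes> l) = m \<otimes> l" using m(2) G h by (simp add: m_assoc[symmetric])
    have ml: "m \<otimes> l \<in> M \<union> M'" using m(1) l by (auto simp: M_def M'_def)
    then have "m \<otimes> l \<in> T' - S" using off T(3) by blast
    have "x3 (m \<otimes> l) = act m xp (m \<otimes> l)"
      using m(1)
    proof
      assume m: "m = k \<otimes> n"
      then have "m \<otimes> l \<in> M" using l by (simp add: M_def)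
      then show ?thesis using x3(2) x2(3) m by simp
    next
      assume m: "m = k' \<otimes> n'"
      then have "m \<otimes> l \<in> M'" using l by (simp add: M'_def)
      then show ?thesis using x3(3) m by simp
    qed
    also have "\<dots> = xp l" using G by (simp add: act_mult)
    finally have "x3 (\<gamma> \<otimes> (h \<otimes> l)) \<noteq> x3 (h \<otimes> l)" using l(3) x3T[OF hl] gm by simp
    moreover have "h \<otimes> l \<in> T' - S" using hl l by (simp add: T'_def)
    ultimately show ?thesis using \<open>m \<otimes> l \<in> T' - S\<close> gm unfolding mismatch_def by metis
  qed
  have new: "mismatch S x3 T' \<gamma>"
    if \<gamma>: "\<gamma> \<in> carrier G" "s \<in> S" "\<gamma> \<otimes> s \<in> T' - T" for \<gamma> s
  proof -
    have sG: "s \<in> carrier G" using \<gamma> T by blast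
    \<comment> \<open>If s lands on a new point r, then s q in \<open>P\<close> lands on the base
      point r q of its copy. If s lands on a point m l of a copy, then s l^-1 in \<open>P\<close>
      lands on the base point m. These two cases are the origin of the inclusions required of
      \<open>P\<close>.\<close>
    have stain: "mismatch S x3 T' \<gamma>" if "\<gamma> \<otimes> s = r" "r \<otimes> q = k \<otimes> n \<or> r \<otimes> q = k' \<otimes> n'" "q \<in> N" for r q
    proof (rule block)
      show "s \<otimes> q \<in> P" using set_multI[OF \<gamma>(2) that(3), of G] P by blast
      have "q \<in> carrier G" using that N by blast
      then show "\<gamma> \<otimes> (s \<otimes> q) = r \<otimes> q" using that \<gamma> sG by (simp add: m_assoc[symmetric])
    qed (use that \<gamma> in auto)
    have copy: "mismatch S x3 T' \<gamma>" if "\<gamma> \<otimes> s = m \<otimes> l" "m = k \<otimes> n \<or> m = k' \<otimes> n'" "l \<in> L" for m l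
    proof (rule block)
      show "s \<otimes> inv l \<in> P" using set_multI[OF \<gamma>(2) imageI[OF that(3)], of G "m_inv G"] P by blast
      have G: "l \<in> carrier G" "m \<in> carrier G" using that L kk' nG n'G by auto
      then have "\<gamma> \<otimes> (s \<otimes> inv l) = \<gamma> \<otimes> s \<otimes> inv l" using \<gamma> sG by (simp add: m_assoc)
      then show "\<gamma> \<otimes> (s \<otimes> inv l) = m" using that(1) G by (simp add: m_assoc)
    qed (use that \<gamma> in auto)
    from \<gamma>(3) consider "\<gamma> \<otimes> s = k" | "\<gamma> \<otimes> s = k'" | "\<gamma> \<otimes> s \<in> M" | "\<gamma> \<otimes> s \<in> M'"
      unfolding off by blast
    then show ?thesis
    proof cases
      case 1
      then show ?thesis using stain[of k n] n by blast
    next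
      case 2
      then show ?thesis using stain[of k' n'] n' by blast
    next
      case 3
      then show ?thesis using copy unfolding M_def by blast
    next
      case 4
      then show ?thesis using copy unfolding M'_def by blast
    qed
  qed
  have "x3 k = z k" "x3 k' = z k'" using x1 x2 x3 by simp_all
  then have "mismatch S x3 T' g"
    using zk \<open>k \<notin> T\<close> \<open>k' \<notin> T\<close> T(3) unfolding mismatch_def k'_def T'_def
    by (intro bexI[of _ k]) auto
  moreover have "finite T'" "T \<subseteq> T'" "T' \<subseteq> carrier G"
    using T finM kk' MG M'G by (auto simp: T'_def)
  moreover have "\<forall>t\<in>T. x3 t = x t" "\<forall>\<gamma>\<in>carrier G. \<forall>s\<in>S. \<gamma> \<otimes> s \<in> T' - T \<longrightarrow> mismatch S x3 T' \<gamma>"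
    using x3T new by simp_all
  ultimately show ?thesis using x3(1) by (intro bexI[of _ x3] exI[of _ T'] conjI)
qed

text \<open>Only the finitely many translations whose window can meet the core \<open>C\<close> are
  treated one by one. Those reaching points added later receive their mismatch from
  \<open>marker_step\<close> itself, so the induction does not chase a growing set.\<close>

lemma marker_exists:
  assumes x0: "x0 \<in> X" and F: "finite F" "F \<subseteq> carrier G" and S: "finite S" "S \<subseteq> carrier G"
  shows "\<exists>x\<in>X. \<exists>T. finite T \<and> F \<union> S \<subseteq> T \<and> T \<subseteq> carrier G \<and> (\<forall>h\<in>F. x h = x0 h) \<and>
    (\<forall>g\<in>carrier G. \<forall>s\<in>S. g \<noteq> \<one> \<longrightarrow> g \<otimes> s \<in> T \<longrightarrow> mismatch S x T g)"
proof -
  obtain a b where ab: "a \<noteq> b"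
    "\<And>h. h \<in> carrier G \<Longrightarrow> \<exists>x\<in>X. x h = a" "\<And>h. h \<in> carrier G \<Longrightarrow> \<exists>x\<in>X. x h = b"
    by (rule two_letters) (rule that)
  \<comment> \<open>The length |L| is fixed before \<open>P\<close>, which depends on
    \<open>L\<close> through S L^-1; the summand 4 is the size of \<open>N\<close>.\<close>
  obtain c where c: "card S * 2 ^ card S * (4 + c) < 2 ^ c"
    using power_dominates_linear by blast
  obtain L where L: "finite L" "L \<subseteq> carrier G" "card L = c"
    "\<And>l m. l \<in> L \<Longrightarrow> m \<in> L \<Longrightarrow> l \<noteq> m \<Longrightarrow> inv l \<otimes> m \<notin> K"
    using separated_set_exists[OF infinite_G finite_K K_carrier, of c] by blast
  define Z where "Z = L <#> K <#> insert \<one> (m_inv G ` L <#> L) <#> m_inv G ` K <#> m_inv G ` L"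
  have iL: "m_inv G ` L \<subseteq> carrier G" "m_inv G ` K \<subseteq> carrier G" using L K_carrier by auto
  have "finite Z" using L finite_K by (simp add: Z_def finite_set_mult)
  moreover have "Z \<subseteq> carrier G"
    unfolding Z_def using L(2) K_carrier iL
    by (intro set_mult_closed insert_subsetI) (auto simp: set_mult_closed)
  ultimately obtain N where N: "finite N" "N \<subseteq> carrier G" "card N = 4"
    "\<And>n m. n \<in> N \<Longrightarrow> m \<in> N \<Longrightarrow> n \<noteq> m \<Longrightarrow> inv n \<otimes> m \<notin> Z"
    using separated_set_exists[OF infinite_G, of Z 4] by blast
  define P where "P = (S <#> N) \<union> (S <#> m_inv G ` L)"
  have P: "finite P" "P \<subseteq> carrier G"
    using S N L iL by (auto simp: P_def finite_set_mult set_mult_closed)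
  have "card P \<le> card (S <#> N) + card (S <#> m_inv G ` L)"
    unfolding P_def by (rule card_Un_le)
  also have "\<dots> \<le> card S * 4 + card S * c"
  proof (rule add_mono)
    show "card (S <#> N) \<le> card S * 4" using card_set_mult_le[of S N G] S N by simp
    have "card (S <#> m_inv G ` L) \<le> card S * card (m_inv G ` L)" using card_set_mult_le S L by blast
    also have "\<dots> \<le> card S * c" using card_image_le[OF L(1), of "m_inv G"] L(3) by simp
    finally show "card (S <#> m_inv G ` L) \<le> card S * c" .
  qed
  finally have "card P * 2 ^ card S \<le> (card S * 4 + card S * c) * 2 ^ card S"
    by (rule mult_le_mono1)
  also have "\<dots> = card S * 2 ^ card S * (4 + c)" by (simp add: algebra_simps)
  also have "\<dots> < 2 ^ card L" using c L(3) by simp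
  finally have "card P * 2 ^ card S < 2 ^ card L" .
  from avoiding_pattern[OF L(1,2) S(1) P ab(1) this, of x0] obtain p where
    p: "\<And>l. l \<in> L \<Longrightarrow> p l \<in> {a, b}" "\<And>h. h \<in> P \<Longrightarrow> \<exists>l\<in>L. h \<otimes> l \<notin> S \<and> p l \<noteq> x0 (h \<otimes> l)"
    by blast
  have "\<exists>x\<in>X. \<forall>l\<in>L. x l = p l"
    by (rule free_patterns[where a = a and b = b]) (fact ab L p)+
  then obtain xp where xp: "xp \<in> X" "\<And>l. l \<in> L \<Longrightarrow> xp l = p l" by blast
  \<comment> \<open>Including \<open>P <#> L\<close> freezes all positions where the pattern is
    compared with \<open>x0\<close>, so its avoidance survives every later step.\<close>
  define C where "C = F \<union> S \<union> (P <#> L)"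
  have C: "finite C" "C \<subseteq> carrier G"
    using F S P L by (auto simp: C_def finite_set_mult set_mult_closed)
  define good where "good D x T \<longleftrightarrow> x \<in> X \<and> finite T \<and> C \<subseteq> T \<and> T \<subseteq> carrier G \<and>
    (\<forall>h\<in>C. x h = x0 h) \<and> (\<forall>g\<in>D. mismatch S x T g) \<and>
    (\<forall>g\<in>carrier G. \<forall>s\<in>S. g \<otimes> s \<in> T - C \<longrightarrow> mismatch S x T g)" for D x T
  have ext: "\<exists>x T. good D x T" if "finite D" "D \<subseteq> carrier G - {\<one>}" for D
    using that
  proof (induction D rule: finite_induct)
    case empty
    have "good {} x0 C" using x0 C by (simp add: good_def)
    then show ?case by blast
  next
    case (insert g D)
    then obtain x T where "good D x T" by auto
    then have x: "x \<in> X" "finite T" "C \<subseteq> T" "T \<subseteq> carrier G" "\<And>h. h \<in> C \<Longrightarrow> x h = x0 h"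
      "\<And>g. g \<in> D \<Longrightarrow> mismatch S x T g"
      "\<And>g s. g \<in> carrier G \<Longrightarrow> s \<in> S \<Longrightarrow> g \<otimes> s \<in> T - C \<Longrightarrow> mismatch S x T g"
      unfolding good_def by blast+
    have avoid: "\<exists>l\<in>L. h \<otimes> l \<notin> S \<and> xp l \<noteq> x (h \<otimes> l)" if h: "h \<in> P" for h
    proof -
      obtain l where l: "l \<in> L" "h \<otimes> l \<notin> S" "p l \<noteq> x0 (h \<otimes> l)" using p(2) h by blast
      then have "h \<otimes> l \<in> C" using set_multI[OF h l(1), of G] by (simp add: C_def)
      then show ?thesis using l x(5) xp(2) by metis
    qed
    have "\<exists>x'\<in>X. \<exists>T'. finite T' \<and> T \<subseteq> T' \<and> T' \<subseteq> carrier G \<and> (\<forall>t\<in>T. x' t = x t) \<and>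
      mismatch S x' T' g \<and> (\<forall>\<gamma>\<in>carrier G. \<forall>s\<in>S. \<gamma> \<otimes> s \<in> T' - T \<longrightarrow> mismatch S x' T' \<gamma>)"
    proof (rule marker_step[where L = L and xp = xp and P = P and N = N])
      show "S \<subseteq> T" "P <#> L \<subseteq> T" using x(3) by (auto simp: C_def)
      show "S <#> N \<subseteq> P" "S <#> m_inv G ` L \<subseteq> P" by (auto simp: P_def)
      show "inv n \<otimes> m \<notin> L <#> K <#> insert \<one> (m_inv G ` L <#> L) <#> m_inv G ` K <#> m_inv G ` L"
        if "n \<in> N" "m \<in> N" "n \<noteq> m" for n m
        using N(4) that unfolding Z_def by blast
      show "g \<in> carrier G" "g \<noteq> \<one>" using insert.prems by auto
    qed (fact x L xp P N avoid)+
    then obtain x' T' where x': "x' \<in> X" "finite T'" "T \<subseteq> T'" "T' \<subseteq> carrier G"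
      "\<And>t. t \<in> T \<Longrightarrow> x' t = x t" "mismatch S x' T' g"
      "\<And>\<gamma> s. \<gamma> \<in> carrier G \<Longrightarrow> s \<in> S \<Longrightarrow> \<gamma> \<otimes> s \<in> T' - T \<Longrightarrow> mismatch S x' T' \<gamma>" by blast
    have mono: "mismatch S x' T' \<gamma>" if "mismatch S x T \<gamma>" for \<gamma>
      using that x'(3,5) by (rule mismatch_mono)
    have "\<forall>\<gamma>\<in>insert g D. mismatch S x' T' \<gamma>"
      using x'(6) x(6) mono by blast
    moreover have "\<forall>g\<in>carrier G. \<forall>s\<in>S. g \<otimes> s \<in> T' - C \<longrightarrow> mismatch S x' T' g"
      using x'(7) x(7) mono by blast
    moreover have "\<forall>h\<in>C. x' h = x0 h" "C \<subseteq> T'" using x(3,5) x'(3,5) by auto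
    ultimately have "good (insert g D) x' T'" using x'(1,2,4) unfolding good_def by blast
    then show ?case by blast
  qed
  define D where "D = (C <#> m_inv G ` S) - {\<one>}"
  have "finite D" using C S by (simp add: D_def finite_set_mult)
  moreover have "m_inv G ` S \<subseteq> carrier G" using S by auto
  then have "D \<subseteq> carrier G - {\<one>}" using set_mult_closed[OF C(2)] unfolding D_def by blast
  ultimately obtain x T where "good D x T" using ext by blast
  then have x: "x \<in> X" "finite T" "C \<subseteq> T" "T \<subseteq> carrier G" "\<forall>h\<in>C. x h = x0 h"
      "\<And>g. g \<in> D \<Longrightarrow> mismatch S x T g"
      "\<And>g s. g \<in> carrier G \<Longrightarrow> s \<in> S \<Longrightarrow> g \<otimes> s \<in> T - C \<Longrightarrow> mismatch S x T g"
    unfolding good_def by blast+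
  have "mismatch S x T g" if g: "g \<in> carrier G" "s \<in> S" "g \<noteq> \<one>" "g \<otimes> s \<in> T" for g s
  proof (cases "g \<otimes> s \<in> C")
    case True
    then have "g \<otimes> s \<otimes> inv s \<in> C <#> m_inv G ` S" using g by (intro set_multI imageI)
    moreover have "s \<in> carrier G" using g S by blast
    ultimately have "g \<in> D" using g by (simp add: D_def m_assoc)
    then show ?thesis by (rule x(6))
  next
    case False
    then show ?thesis using x(7) g by blast
  qed
  moreover have "F \<union> S \<subseteq> T" "\<forall>h\<in>F. x h = x0 h" using x(3,5) by (auto simp: C_def)
  ultimately show ?thesis using x(1,2,4) by blast
qed

end

section \<open>Swapping fillings at markers\<close>

text \<open>The part \<open>T - K\<close> marks the place, and \<open>x\<close> on \<open>K\<close>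
  and \<open>q\<close> are the two fillings to be exchanged. By \<open>no_overlap\<close>, windows
  keep away from the whole support \<open>T\<close> of other occurrences, while the parts off the
  windows may overlap.\<close>

locale marker = si_subshift G A X K
    for G (structure) and A :: "'a set" and X :: "('g \<Rightarrow> 'a) set" and K +
  fixes x T q
  assumes x_X: "x \<in> X" and finite_T: "finite T" and T_carrier: "T \<subseteq> carrier G" and K_T: "K \<subseteq> T"
    and no_overlap: "\<And>g s. g \<in> carrier G \<Longrightarrow> s \<in> K \<Longrightarrow> g \<noteq> \<one> \<Longrightarrow> g \<otimes> s \<in> T \<Longrightarrow> mismatch K x T g"
    and stable: "\<And>y. y \<in> X \<Longrightarrow> (\<And>h. h \<in> T - K \<Longrightarrow> y h = x h) \<Longrightarrow> fillings y = fillings x"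
    and q: "q \<in> fillings x" "q \<noteq> restrict x K"
begin

definition flip :: "('g \<Rightarrow> 'a) \<Rightarrow> 'g \<Rightarrow> 'a" where
  "flip u = (if u = restrict x K then q else if u = q then restrict x K else u)"

text \<open>The window is left out of the test, so an occurrence remains one when its own filling is
  exchanged.\<close>

definition occurrences :: "('g \<Rightarrow> 'a) \<Rightarrow> 'g set" where
  "occurrences y = {g \<in> carrier G. \<forall>t\<in>T - K. y (g \<otimes> t) = x t}"

definition view :: "('g \<Rightarrow> 'a) \<Rightarrow> 'g \<Rightarrow> 'g \<Rightarrow> 'a" where
  "view y g = (\<lambda>s\<in>K. y (g \<otimes> s))"

text \<open>The choice is unambiguous by \<open>occurrences_unique\<close>. The set \<open>P\<close>
  of places allowed to act is a parameter because membership in \<open>X\<close> is first shown for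
  finite \<open>P\<close> by induction; the automorphism is the case \<open>UNIV\<close>.\<close>

definition swap :: "'g set \<Rightarrow> ('g \<Rightarrow> 'a) \<Rightarrow> 'g \<Rightarrow> 'a" where
  "swap P y = (\<lambda>k\<in>carrier G.
     if \<exists>g. g \<in> P \<inter> occurrences y \<and> inv g \<otimes> k \<in> K
     then let g = SOME g. g \<in> P \<inter> occurrences y \<and> inv g \<otimes> k \<in> K in flip (view y g) (inv g \<otimes> k)
     else y k)"

lemma flip_flip: "flip (flip u) = u"
  using q by (auto simp: flip_def)

lemma flip_fillings: "u \<in> fillings x \<Longrightarrow> flip u \<in> fillings x"
  using q restrict_fillings[OF x_X] by (auto simp: flip_def)

lemma flip_PiE: "u \<in> K \<rightarrow>\<^sub>E A \<Longrightarrow> flip u \<in> K \<rightarrow>\<^sub>E A"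
  using q restrict_fillings[OF x_X] by (auto simp: flip_def fillings_def simp del: PiE_iff)

lemma occurrences_carrier: "g \<in> occurrences y \<Longrightarrow> g \<in> carrier G"
  by (simp add: occurrences_def)

text \<open>If a window met the support of another occurrence, the mismatch for
  \<open>inv h \<otimes> g\<close> would force two values on one coordinate of
  \<open>y\<close>.\<close>

lemma occurrences_unique:
  assumes g: "g \<in> occurrences y" and h: "h \<in> occurrences y" and k: "k \<in> carrier G"
    and gk: "inv g \<otimes> k \<in> K" and hk: "inv h \<otimes> k \<in> T"
  shows "g = h"
proof (rule ccontr)
  assume "g \<noteq> h"
  have G: "g \<in> carrier G" "h \<in> carrier G" using g h by (auto dest: occurrences_carrier)
  have "inv h \<otimes> g \<noteq> \<one>"
    using \<open>g \<noteq> h\<close> G by (metis inv_closed inv_equality inv_inv)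
  moreover have "inv h \<otimes> g \<otimes> (inv g \<otimes> k) \<in> T" using hk G k by (simp add: group_normalize)
  ultimately obtain j where j: "j \<in> T - K" "inv h \<otimes> g \<otimes> j \<in> T - K" "x (inv h \<otimes> g \<otimes> j) \<noteq> x j"
    using no_overlap[of "inv h \<otimes> g" "inv g \<otimes> k"] gk G by (auto simp: mismatch_def)
  have "j \<in> carrier G" using j T_carrier by blast
  then have "h \<otimes> (inv h \<otimes> g \<otimes> j) = g \<otimes> j" using G by (simp add: group_normalize)
  moreover have "y (h \<otimes> (inv h \<otimes> g \<otimes> j)) = x (inv h \<otimes> g \<otimes> j)" "y (g \<otimes> j) = x j"
    using g h j by (auto simp: occurrences_def)
  ultimately show False using j(3) by simp
qed

lemma swap_on:
  assumes g: "g \<in> P" "g \<in> occurrences y" and k: "k \<in> carrier G" "inv g \<otimes> k \<in> K"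
  shows "swap P y k = flip (view y g) (inv g \<otimes> k)"
proof -
  have "(SOME g. g \<in> P \<inter> occurrences y \<and> inv g \<otimes> k \<in> K) = g"
  proof (rule some_equality)
    show "h = g" if "h \<in> P \<inter> occurrences y \<and> inv h \<otimes> k \<in> K" for h
      using occurrences_unique[of h y g k] that g k K_T by blast
  qed (use g k in simp)
  then show ?thesis using g k by (auto simp: swap_def)
qed

lemma swap_off:
  assumes "k \<in> carrier G" "\<And>g. g \<in> P \<Longrightarrow> g \<in> occurrences y \<Longrightarrow> inv g \<otimes> k \<notin> K"
  shows "swap P y k = y k"
  using assms by (auto simp: swap_def)

lemma swap_cases:
  assumes "k \<in> carrier G"
  obtains g where "g \<in> P" "g \<in> occurrences y" "inv g \<otimes> k \<in> K"
  | "\<And>g. g \<in> P \<Longrightarrow> g \<in> occurrences y \<Longrightarrow> inv g \<otimes> k \<notin> K"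
  by blast

lemma swap_cong: "P \<inter> occurrences y = P' \<inter> occurrences y \<Longrightarrow> swap P y = swap P' y"
  unfolding swap_def by presburger

lemma view_PiE:
  assumes "y \<in> carrier G \<rightarrow>\<^sub>E A" "g \<in> carrier G"
  shows "view y g \<in> K \<rightarrow>\<^sub>E A"
  unfolding view_def restrict_PiE_iff using assms K_carrier by (blast intro: PiE_mem)

lemma swap_full:
  assumes y: "y \<in> carrier G \<rightarrow>\<^sub>E A"
  shows "swap P y \<in> carrier G \<rightarrow>\<^sub>E A"
proof (rule PiE_I)
  fix k assume k: "k \<in> carrier G"
  show "swap P y k \<in> A"
  proof (rule swap_cases[OF k, of P y])
    fix g assume g: "g \<in> P" "g \<in> occurrences y" "inv g \<otimes> k \<in> K"
    have "flip (view y g) \<in> K \<rightarrow>\<^sub>E A"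
      by (intro flip_PiE view_PiE y occurrences_carrier[OF g(2)])
    then show ?thesis using swap_on[OF g(1,2) k g(3)] PiE_mem[OF _ g(3)] by simp
  next
    assume "\<And>g. g \<in> P \<Longrightarrow> g \<in> occurrences y \<Longrightarrow> inv g \<otimes> k \<notin> K"
    then show ?thesis using swap_off[OF k, of P y] PiE_mem[OF y k] by simp
  qed
qed (simp add: swap_def)

text \<open>An occurrence of \<open>swap P y\<close> that is not one of \<open>y\<close> would meet a swapped window, but the
  occurrences of \<open>y\<close> persist and exclude this.\<close>

lemma occurrences_swap: "occurrences (swap P y) = occurrences y"
proof
  show sub: "occurrences y \<subseteq> occurrences (swap P y)"
  proof
    fix g assume g: "g \<in> occurrences y"
    have gG: "g \<in> carrier G" using g by (rule occurrences_carrier)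
    have "swap P y (g \<otimes> t) = x t" if t: "t \<in> T - K" for t
    proof -
      have tG: "t \<in> carrier G" using t T_carrier by blast
      have gt: "inv g \<otimes> (g \<otimes> t) = t" using gG tG by (simp add: inv_mult_cancel)
      have "swap P y (g \<otimes> t) = y (g \<otimes> t)"
      proof (rule swap_off)
        fix h assume h: "h \<in> P" "h \<in> occurrences y"
        show "inv h \<otimes> (g \<otimes> t) \<notin> K"
        proof
          assume K: "inv h \<otimes> (g \<otimes> t) \<in> K"
          then have "h = g"
            using occurrences_unique[OF h(2) g, of "g \<otimes> t"] gG tG t gt by simp
          then show False using K gt t by simp
        qed
      qed (use gG tG in simp)
      then show ?thesis using g t by (simp add: occurrences_def)
    qed
    then show "g \<in> occurrences (swap P y)" using gG by (simp add: occurrences_def)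
  qed
  show "occurrences (swap P y) \<subseteq> occurrences y"
  proof
    fix g assume g: "g \<in> occurrences (swap P y)"
    have gG: "g \<in> carrier G" using g by (rule occurrences_carrier)
    have "y (g \<otimes> t) = x t" if t: "t \<in> T - K" for t
    proof -
      have tG: "t \<in> carrier G" using t T_carrier by blast
      have gt: "inv g \<otimes> (g \<otimes> t) = t" using gG tG by (simp add: inv_mult_cancel)
      have "swap P y (g \<otimes> t) = y (g \<otimes> t)"
      proof (rule swap_off)
        fix h assume h: "h \<in> P" "h \<in> occurrences y"
        show "inv h \<otimes> (g \<otimes> t) \<notin> K"
        proof
          assume K: "inv h \<otimes> (g \<otimes> t) \<in> K"
          then have "h = g"
            using occurrences_unique[of h "swap P y" g "g \<otimes> t"] sub h g gG tG t gt by auto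
          then show False using K gt t by simp
        qed
      qed (use gG tG in simp)
      then show ?thesis using g t by (simp add: occurrences_def)
    qed
    then show "g \<in> occurrences y" using gG by (simp add: occurrences_def)
  qed
qed

lemma view_swap_on:
  assumes "g \<in> P" "g \<in> occurrences y"
    and y: "y \<in> carrier G \<rightarrow>\<^sub>E A"
  shows "view (swap P y) g = flip (view y g)"
proof (rule PiE_ext)
  have gG: "g \<in> carrier G" using assms by (blast dest: occurrences_carrier)
  show "view (swap P y) g \<in> K \<rightarrow>\<^sub>E A" by (intro view_PiE swap_full y gG)
  show "flip (view y g) \<in> K \<rightarrow>\<^sub>E A" by (intro view_PiE flip_PiE y gG)
  fix s assume s: "s \<in> K"
  then have "s \<in> carrier G" using K_carrier by blast
  then show "view (swap P y) g s = flip (view y g) s"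
    using swap_on[OF assms(1,2), of "g \<otimes> s"] s gG by (simp add: view_def inv_mult_cancel)
qed

lemma view_swap_off:
  assumes "g \<notin> P" "g \<in> occurrences y"
  shows "view (swap P y) g = view y g"
proof
  fix s
  have gG: "g \<in> carrier G" using assms by (blast dest: occurrences_carrier)
  show "view (swap P y) g s = view y g s"
  proof (cases "s \<in> K")
    case True
    then have s: "s \<in> carrier G" using K_carrier by blast
    have "swap P y (g \<otimes> s) = y (g \<otimes> s)"
    proof (rule swap_off)
      fix h assume h: "h \<in> P" "h \<in> occurrences y"
      show "inv h \<otimes> (g \<otimes> s) \<notin> K"
        using occurrences_unique[OF h(2) assms(2), of "g \<otimes> s"] assms(1) h(1) K_T True s gG
        by (auto simp: inv_mult_cancel)
    qed (use gG s in simp)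
    then show ?thesis by (simp add: view_def)
  qed (simp add: view_def)
qed

lemma swap_swap:
  assumes y: "y \<in> carrier G \<rightarrow>\<^sub>E A"
  shows "swap P (swap P y) = y"
proof (rule PiE_ext)
  show "swap P (swap P y) \<in> carrier G \<rightarrow>\<^sub>E A" by (intro swap_full y)
  show "y \<in> carrier G \<rightarrow>\<^sub>E A" by (rule y)
  fix k assume k: "k \<in> carrier G"
  show "swap P (swap P y) k = y k"
  proof (rule swap_cases[OF k, of P y])
    fix g assume g: "g \<in> P" "g \<in> occurrences y" "inv g \<otimes> k \<in> K"
    then have "swap P (swap P y) k = view y g (inv g \<otimes> k)"
      using swap_on[of g P "swap P y" k] k view_swap_on[OF g(1,2) y]
      by (simp add: occurrences_swap flip_flip)
    also have "\<dots> = y k" using g k occurrences_carrier[OF g(2)] by (simp add: view_def mult_inv_cancel)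
    finally show ?thesis .
  next
    assume off: "\<And>g. g \<in> P \<Longrightarrow> g \<in> occurrences y \<Longrightarrow> inv g \<otimes> k \<notin> K"
    then show ?thesis
      using swap_off[OF k, of P y] swap_off[OF k, of P "swap P y"] by (simp add: occurrences_swap)
  qed
qed

text \<open>Stability enters here: once the occurrence is translated to \<open>\<one>\<close>, the
  exterior of the window has the same fillings as \<open>x\<close>, and \<open>flip\<close> permutes
  these.\<close>

lemma swap_single:
  assumes y: "y \<in> X" and g: "g \<in> occurrences y"
  shows "swap {g} y \<in> X"
proof -
  have gG: "g \<in> carrier G" using g by (rule occurrences_carrier)
  define z where "z = act (inv g) y"
  have z: "z \<in> X" using y gG by (simp add: z_def act_X)
  have zk: "z k = y (g \<otimes> k)" if "k \<in> carrier G" for k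
    using that gG by (simp add: z_def act_apply)
  have "z h = x h" if "h \<in> T - K" for h
  proof -
    have "h \<in> carrier G" using that T_carrier by blast
    then show ?thesis using zk g that by (simp add: occurrences_def)
  qed
  then have fz: "fillings z = fillings x" using stable z by blast
  have "view y g = restrict z K"
    unfolding view_def using zk K_carrier by (intro restrict_ext) auto
  then have "flip (view y g) \<in> fillings z"
    using restrict_fillings[OF z] flip_fillings fz by simp
  then have oX: "override_on z (flip (view y g)) K \<in> X" by (simp add: fillings_def)
  have "swap {g} y = act g (override_on z (flip (view y g)) K)"
  proof (rule PiE_ext)
    show "swap {g} y \<in> carrier G \<rightarrow>\<^sub>E A" using y X_subset by (intro swap_full) blast
    show "act g (override_on z (flip (view y g)) K) \<in> carrier G \<rightarrow>\<^sub>E A"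
      using act_X[OF gG oX] X_subset by blast
    fix k assume k: "k \<in> carrier G"
    show "swap {g} y k = act g (override_on z (flip (view y g)) K) k"
    proof (cases "inv g \<otimes> k \<in> K")
      case True
      then show ?thesis using swap_on[of g "{g}" y k] g k by (simp add: act_apply)
    next
      case False
      then show ?thesis using swap_off[of k "{g}" y] k gG zk[of "inv g \<otimes> k"]
        by (simp add: act_apply mult_inv_cancel)
    qed
  qed
  then show ?thesis using act_X[OF gG oX] by simp
qed

text \<open>Windows of distinct occurrences are disjoint, so swapping at \<open>P\<close> leaves the
  content seen at \<open>g\<close> intact and swaps can be made one at a time.\<close>

lemma swap_insert:
  assumes y: "y \<in> X" and g: "g \<in> occurrences y" "g \<notin> P"
  shows "swap (insert g P) y = swap {g} (swap P y)"
proof (rule PiE_ext)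
  have yA: "y \<in> carrier G \<rightarrow>\<^sub>E A" using y X_subset by blast
  show "swap (insert g P) y \<in> carrier G \<rightarrow>\<^sub>E A" "swap {g} (swap P y) \<in> carrier G \<rightarrow>\<^sub>E A"
    by (intro swap_full yA)+
  fix k assume k: "k \<in> carrier G"
  show "swap (insert g P) y k = swap {g} (swap P y) k"
  proof (cases "inv g \<otimes> k \<in> K")
    case True
    then show ?thesis
      using swap_on[of g "insert g P" y k] swap_on[of g "{g}" "swap P y" k] g k
        view_swap_off[OF g(2,1)] by (simp add: occurrences_swap)
  next
    case False
    then have 1: "swap {g} (swap P y) k = swap P y k" using swap_off[of k "{g}"] k by simp
    show ?thesis
    proof (rule swap_cases[OF k, of P y])
      fix h assume h: "h \<in> P" "h \<in> occurrences y" "inv h \<otimes> k \<in> K"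
      then show ?thesis using swap_on[of h "insert g P" y k] swap_on[of h P y k] k 1 by simp
    next
      assume "\<And>h. h \<in> P \<Longrightarrow> h \<in> occurrences y \<Longrightarrow> inv h \<otimes> k \<notin> K"
      then show ?thesis using swap_off[of k "insert g P" y] swap_off[of k P y] k 1 False by auto
    qed
  qed
qed

lemma swap_finite:
  assumes y: "y \<in> X" and P: "finite P"
  shows "swap P y \<in> X"
  using P
proof (induction P rule: finite_induct)
  case empty
  have yA: "y \<in> carrier G \<rightarrow>\<^sub>E A" using y X_subset by blast
  have "swap {} y = y"
    by (rule PiE_ext[OF swap_full[OF yA] yA], rule swap_off) simp_all
  then show ?case using y by simp
next
  case (insert g P)
  show ?case
  proof (cases "g \<in> occurrences y")
    case True
    then show ?thesis
      using swap_insert[OF y True insert.hyps(2)] swap_single[OF insert.IH] by (simp add: occurrences_swap)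
  next
    case False
    then have "swap (insert g P) y = swap P y" by (intro swap_cong) auto
    then show ?thesis using insert.IH by simp
  qed
qed

text \<open>A finite witness against membership meets only finitely many windows, namely those
  placed in F K^-1, so there the full swap agrees with a finite one.\<close>

lemma swap_X:
  assumes y: "y \<in> X"
  shows "swap UNIV y \<in> X"
proof (rule ccontr)
  assume notX: "swap UNIV y \<notin> X"
  have "swap UNIV y \<in> carrier G \<rightarrow>\<^sub>E A" using y X_subset by (intro swap_full) blast
  from not_in_X_witness[OF this notX] obtain F where F: "finite F" "F \<subseteq> carrier G"
    "\<forall>z\<in>X. \<exists>h\<in>F. z h \<noteq> swap UNIV y h" by blast
  define P where "P = {g \<in> carrier G. \<exists>k\<in>F. inv g \<otimes> k \<in> K}"
  have "P \<subseteq> F <#> m_inv G ` K"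
  proof
    fix g assume "g \<in> P"
    then obtain k where k: "g \<in> carrier G" "k \<in> F" "inv g \<otimes> k \<in> K" by (auto simp: P_def)
    then have "k \<otimes> inv (inv g \<otimes> k) \<in> F <#> m_inv G ` K" by (intro set_multI imageI)
    moreover have "k \<in> carrier G" using k F by blast
    ultimately show "g \<in> F <#> m_inv G ` K" using k by (simp add: group_normalize)
  qed
  then have "finite P" using F finite_K by (meson finite_imageI finite_set_mult finite_subset)
  then have "swap P y \<in> X" using swap_finite y by blast
  then obtain k where k: "k \<in> F" "swap P y k \<noteq> swap UNIV y k" using F(3) by blast
  have kG: "k \<in> carrier G" using k F by blast
  show False
  proof (rule swap_cases[OF kG, of UNIV y])
    fix g assume g: "g \<in> occurrences y" "inv g \<otimes> k \<in> K"
    then have "g \<in> P" using k occurrences_carrier by (auto simp: P_def)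
    then show False using swap_on[of g P y k] swap_on[of g UNIV y k] g kG k by simp
  next
    assume "\<And>g. g \<in> UNIV \<Longrightarrow> g \<in> occurrences y \<Longrightarrow> inv g \<otimes> k \<notin> K"
    then show False using swap_off[OF kG, of P y] swap_off[OF kG, of UNIV y] k by auto
  qed
qed

section \<open>Equivariance and locality of the full swap\<close>

lemma occurrences_act:
  assumes g: "g \<in> carrier G" and h: "h \<in> carrier G"
  shows "g \<otimes> h \<in> occurrences (act g y) \<longleftrightarrow> h \<in> occurrences y"
proof -
  have "act g y (g \<otimes> h \<otimes> t) = y (h \<otimes> t)" if "t \<in> T - K" for t
  proof -
    have "t \<in> carrier G" using that T_carrier by blast
    then show ?thesis using g h by (simp add: act_mult m_assoc)
  qed
  then show ?thesis using g h by (simp add: occurrences_def)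
qed

lemma view_act:
  assumes g: "g \<in> carrier G" and h: "h \<in> carrier G"
  shows "view (act g y) (g \<otimes> h) = view y h"
  unfolding view_def
proof (rule restrict_ext)
  fix s assume "s \<in> K"
  then have "s \<in> carrier G" using K_carrier by blast
  then show "act g y (g \<otimes> h \<otimes> s) = y (h \<otimes> s)" using g h by (simp add: act_mult m_assoc)
qed

lemma swap_act:
  assumes g: "g \<in> carrier G" and y: "y \<in> X"
  shows "swap UNIV (act g y) = act g (swap UNIV y)"
proof (rule X_eqI)
  show "swap UNIV (act g y) \<in> X" "act g (swap UNIV y) \<in> X" using swap_X act_X g y by auto
  fix k assume k: "k \<in> carrier G"
  define j where "j = inv g \<otimes> k"
  have j: "j \<in> carrier G" "k = g \<otimes> j" using g k by (simp_all add: j_def mult_inv_cancel)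
  have inv_gh: "inv (g \<otimes> h) \<otimes> (g \<otimes> j) = inv h \<otimes> j" if "h \<in> carrier G" for h
    using that g j by (simp add: group_normalize)
  have rhs: "act g (swap UNIV y) k = swap UNIV y j" using j act_mult g by simp
  show "swap UNIV (act g y) k = act g (swap UNIV y) k"
  proof (rule swap_cases[OF j(1), of UNIV y])
    fix h assume h: "h \<in> occurrences y" "inv h \<otimes> j \<in> K"
    have hG: "h \<in> carrier G" using h by (blast dest: occurrences_carrier)
    have "swap UNIV (act g y) (g \<otimes> j) = flip (view (act g y) (g \<otimes> h)) (inv (g \<otimes> h) \<otimes> (g \<otimes> j))"
      using occurrences_act[OF g hG] h inv_gh[OF hG] g j by (intro swap_on) auto
    also have "\<dots> = swap UNIV y j"
      using swap_on[of h UNIV y j] h j view_act[OF g hG] inv_gh[OF hG] by simp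
    finally show ?thesis using rhs j by simp
  next
    assume off: "\<And>h. h \<in> UNIV \<Longrightarrow> h \<in> occurrences y \<Longrightarrow> inv h \<otimes> j \<notin> K"
    have "swap UNIV (act g y) (g \<otimes> j) = act g y (g \<otimes> j)"
    proof (rule swap_off)
      fix h assume h: "h \<in> occurrences (act g y)"
      have hG: "h \<in> carrier G" using h by (rule occurrences_carrier)
      define i where "i = inv g \<otimes> h"
      have i: "i \<in> carrier G" "h = g \<otimes> i" using g hG by (simp_all add: i_def mult_inv_cancel)
      then have "i \<in> occurrences y" using occurrences_act[OF g] h by simp
      then show "inv h \<otimes> (g \<otimes> j) \<notin> K" using off inv_gh[OF i(1)] i(2) by simp
    qed (use g j in simp)
    then show ?thesis using rhs j g act_mult swap_off[of j UNIV y] off by simp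
  qed
qed

lemma swap_local:
  assumes k: "k \<in> carrier G"
  shows "\<exists>M. finite M \<and> M \<subseteq> carrier G \<and>
    (\<forall>y\<in>X. \<forall>z\<in>X. (\<forall>m\<in>M. y m = z m) \<longrightarrow> swap UNIV y k = swap UNIV z k)"
proof -
  \<comment> \<open>An occurrence whose window covers k lies in k K^-1; testing it and reading its
    window takes only its translate of \<open>T\<close>.\<close>
  define M where "M = {k} <#> m_inv G ` K <#> T"
  have "m_inv G ` K \<subseteq> carrier G" using K_carrier by auto
  then have "M \<subseteq> carrier G" using k T_carrier by (simp add: M_def set_mult_closed)
  moreover have "finite M" using finite_K finite_T by (simp add: M_def finite_set_mult)
  moreover have "swap UNIV y k = swap UNIV z k" if yz: "\<forall>m\<in>M. y m = z m" for y z
  proof -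
    have eq: "y (g \<otimes> t) = z (g \<otimes> t)" if g: "g \<in> carrier G" "inv g \<otimes> k \<in> K" "t \<in> T" for g t
    proof -
      have "k \<otimes> inv (inv g \<otimes> k) \<otimes> t \<in> M" unfolding M_def using g by (intro set_multI imageI) auto
      moreover have "k \<otimes> inv (inv g \<otimes> k) = g" using g k by (simp add: group_normalize)
      ultimately show ?thesis using yz by simp
    qed
    then have occ: "g \<in> occurrences y \<longleftrightarrow> g \<in> occurrences z" if "g \<in> carrier G" "inv g \<otimes> k \<in> K" for g
      using that by (auto simp: occurrences_def)
    have vw: "view y g = view z g" if "g \<in> carrier G" "inv g \<otimes> k \<in> K" for g
      unfolding view_def using eq[OF that] K_T by (intro restrict_ext) auto
    show ?thesis
    proof (rule swap_cases[OF k, of UNIV y])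
      fix g assume g: "g \<in> occurrences y" "inv g \<otimes> k \<in> K"
      have gG: "g \<in> carrier G" using g by (blast dest: occurrences_carrier)
      show ?thesis
        using swap_on[of g UNIV y k] swap_on[of g UNIV z k] g k occ[OF gG g(2)] vw[OF gG g(2)] by simp
    next
      assume off: "\<And>g. g \<in> UNIV \<Longrightarrow> g \<in> occurrences y \<Longrightarrow> inv g \<otimes> k \<notin> K"
      have "inv g \<otimes> k \<notin> K" if "g \<in> occurrences z" for g
        using off[of g] occ[of g] that occurrences_carrier by blast
      moreover have "k \<in> M"
      proof -
        have "k \<otimes> inv \<one> \<otimes> \<one> \<in> M" unfolding M_def using one_K K_T by (intro set_multI imageI) auto
        then show ?thesis using k by simp
      qed
      ultimately show ?thesis using swap_off[of k UNIV y] swap_off[of k UNIV z] off k yz by simp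
    qed
  qed
  then have "\<forall>y\<in>X. \<forall>z\<in>X. (\<forall>m\<in>M. y m = z m) \<longrightarrow> swap UNIV y k = swap UNIV z k"
    by blast
  ultimately show ?thesis by (intro exI[of _ M] conjI)
qed

text \<open>As an involution the swap is its own inverse, so its continuity already makes it a
  homeomorphism.\<close>

lemma swap_automorphism: "restrict (swap UNIV) X \<in> carrier (Aut_group G A X)"
proof -
  let ?f = "restrict (swap UNIV) X"
  have yA: "y \<in> carrier G \<rightarrow>\<^sub>E A" if "y \<in> X" for y using that X_subset by blast
  have fX: "?f y \<in> X" if "y \<in> X" for y using that swap_X by simp
  have ff: "?f (?f y) = y" if "y \<in> X" for y using that swap_X swap_swap[OF yA] by simp
  have cont: "continuous_map topX topX ?f"
  proof (rule local_continuous[OF fX])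
    fix h assume "h \<in> carrier G"
    from swap_local[OF this] obtain M where M: "finite M" "M \<subseteq> carrier G"
      "\<forall>y\<in>X. \<forall>z\<in>X. (\<forall>m\<in>M. y m = z m) \<longrightarrow> swap UNIV y h = swap UNIV z h" by blast
    have "?f y h = ?f z h" if yz: "y \<in> X" "z \<in> X" "\<forall>m\<in>M. y m = z m" for y z
    proof -
      have "swap UNIV y h = swap UNIV z h" using yz M(3) by blast
      then show ?thesis using yz(1,2) by simp
    qed
    then have "\<forall>y\<in>X. \<forall>z\<in>X. (\<forall>m\<in>M. y m = z m) \<longrightarrow> ?f y h = ?f z h" by blast
    with M(1,2) show "\<exists>M. finite M \<and> M \<subseteq> carrier G \<and>
        (\<forall>x\<in>X. \<forall>y\<in>X. (\<forall>m\<in>M. x m = y m) \<longrightarrow> ?f x h = ?f y h)"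
      by (intro exI[of _ M] conjI)
  qed
  then have "homeomorphic_maps topX topX ?f ?f"
    using ff unfolding homeomorphic_maps_def topspace_topX by blast
  then have "homeomorphic_map topX topX ?f" by (auto simp: homeomorphic_map_maps)
  moreover have "bij_betw ?f X X"
    by (rule bij_betw_byWitness[where f' = ?f]) (use fX ff in auto)
  moreover have "?f (act g y) = act g (?f y)" if "g \<in> carrier G" "y \<in> X" for g y
    using that swap_act act_X by simp
  ultimately show ?thesis by (simp add: Aut_group_def Bij_def)
qed

lemma swap_moves_marker: "\<exists>k\<in>K. swap UNIV x k \<noteq> x k"
proof -
  have x1: "x (\<one> \<otimes> t) = x t" if "t \<in> T" for t
  proof -
    have "t \<in> carrier G" using that T_carrier by blast
    then show ?thesis by simp
  qed
  have occ: "\<one> \<in> occurrences x" using x1 by (auto simp: occurrences_def)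
  have "view x \<one> = restrict x K" unfolding view_def using x1 K_T by (intro restrict_ext) auto
  then have flip: "flip (view x \<one>) = q" by (simp add: flip_def)
  obtain s where s: "s \<in> K" "q s \<noteq> x s"
  proof -
    have "q \<in> extensional K" using q(1) by (auto simp: fillings_def PiE_def)
    then have "\<exists>s\<in>K. q s \<noteq> restrict x K s"
      using q(2) extensionalityI[of q K "restrict x K"] by auto
    then show ?thesis using that by auto
  qed
  moreover have "s \<in> carrier G" using s K_carrier by blast
  then have "swap UNIV x s = q s" using swap_on[of \<one> UNIV x s] occ s flip by simp
  ultimately show ?thesis by (intro bexI[of _ s]) simp_all
qed

end

section \<open>Automorphisms commuting with all automorphisms\<close>

context group_subshift
begin

lemma Aut_D:
  assumes "f \<in> carrier (Aut_group G A X)"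
  shows "f \<in> Bij X" "homeomorphic_map topX topX f"
    "\<And>g y. g \<in> carrier G \<Longrightarrow> y \<in> X \<Longrightarrow> f (act g y) = act g (f y)"
    "\<And>y. y \<in> X \<Longrightarrow> f y \<in> X"
  using assms by (auto simp: Aut_group_def Bij_def bij_betw_def)

text \<open>Equivariance carries the finite dependence at \<open>\<one>\<close> to every
  \<open>h\<close>, so the translates of a single memory set serve all coordinates.\<close>

lemma Aut_uniform_memory:
  assumes f: "f \<in> carrier (Aut_group G A X)"
  obtains M where "finite M" "M \<subseteq> carrier G"
    "\<And>h y z. h \<in> carrier G \<Longrightarrow> y \<in> X \<Longrightarrow> z \<in> X \<Longrightarrow> (\<And>m. m \<in> M \<Longrightarrow> y (h \<otimes> m) = z (h \<otimes> m)) \<Longrightarrow>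
      f y h = f z h"
proof -
  have "continuous_map topX topX f"
    using Aut_D(2)[OF f] by (rule homeomorphic_imp_continuous_map)
  from continuous_local[OF this one_closed] obtain M where M: "finite M" "M \<subseteq> carrier G"
    "\<forall>y\<in>X. \<forall>z\<in>X. (\<forall>m\<in>M. y m = z m) \<longrightarrow> f y \<one> = f z \<one>" by blast
  show ?thesis
  proof (rule that[OF M(1,2)])
    fix h y z
    assume h: "h \<in> carrier G" and y: "y \<in> X" and z: "z \<in> X"
      and yz: "\<And>m. m \<in> M \<Longrightarrow> y (h \<otimes> m) = z (h \<otimes> m)"
    have shift: "f u h = f (act (inv h) u) \<one>" if "u \<in> X" for u
      using Aut_D(3)[OF f, of "inv h" u] h that by (simp add: act_apply)
    have "\<forall>m\<in>M. act (inv h) y m = act (inv h) z m"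
    proof
      fix m assume "m \<in> M"
      then have "m \<in> carrier G" "y (h \<otimes> m) = z (h \<otimes> m)" using M(2) yz by blast+
      then show "act (inv h) y m = act (inv h) z m" using h by (simp add: act_apply)
    qed
    moreover have "act (inv h) y \<in> X" "act (inv h) z \<in> X" using y z h by (simp_all add: act_X)
    ultimately have "f (act (inv h) y) \<one> = f (act (inv h) z) \<one>" using M(3) by blast
    then show "f y h = f z h" using shift y z by simp
  qed
qed

end

context si_subshift
begin

text \<open>Stability is arranged first and survives the enlargement of the support, because
  \<open>marker_exists\<close> keeps the configuration on \<open>F\<close>. Agreement with
  \<open>x0\<close> is given up on \<open>K\<close>, where \<open>stable_fillings\<close> imposes
  none.\<close>

lemma marker_locale_exists:
  assumes x0: "x0 \<in> X" and F0: "finite F0" "F0 \<subseteq> carrier G"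
  obtains x T q where "marker G A X K x T q" "F0 \<subseteq> T" "\<And>h. h \<in> F0 - K \<Longrightarrow> x h = x0 h"
proof -
  obtain x1 F where x1: "x1 \<in> X" "finite F" "F \<subseteq> carrier G" "F0 \<subseteq> F" "K \<subseteq> F"
    "\<And>h. h \<in> F0 - K \<Longrightarrow> x1 h = x0 h"
    "\<And>y. y \<in> X \<Longrightarrow> (\<And>h. h \<in> F - K \<Longrightarrow> y h = x1 h) \<Longrightarrow> fillings y = fillings x1"
    using stable_fillings[OF x0 F0] by blast
  obtain x T where x: "x \<in> X" "finite T" "F \<union> K \<subseteq> T" "T \<subseteq> carrier G" "\<forall>h\<in>F. x h = x1 h"
    "\<And>g s. g \<in> carrier G \<Longrightarrow> s \<in> K \<Longrightarrow> g \<noteq> \<one> \<Longrightarrow> g \<otimes> s \<in> T \<Longrightarrow> mismatch K x T g"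
    using marker_exists[OF x1(1-3) finite_K K_carrier] by blast
  obtain q where q: "q \<in> fillings x" "q \<one> \<noteq> x \<one>" using other_filling[OF x(1)] by blast
  have fx: "fillings x = fillings x1" using x1(7)[OF x(1)] x(5) by simp
  have "marker G A X K x T q"
  proof (intro marker.intro marker_axioms.intro si_subshift_axioms)
    show "fillings y = fillings x" if y: "y \<in> X" "\<And>h. h \<in> T - K \<Longrightarrow> y h = x h" for y
    proof -
      have "y h = x1 h" if "h \<in> F - K" for h using y(2)[of h] x(3,5) that by auto
      then show ?thesis using x1(7)[OF y(1)] fx by simp
    qed
    show "q \<noteq> restrict x K" using q(2) one_K by auto
    show "K \<subseteq> T" using x(3) by simp
  qed (fact x q)+
  moreover have "F0 \<subseteq> T" using x(3) x1(4) by blast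
  moreover have "x h = x0 h" if "h \<in> F0 - K" for h
    using that x1(4,6) x(5) by (metis DiffD1 subsetD)
  ultimately show ?thesis by (rule that)
qed

text \<open>Without an occurrence of the marker in \<open>f x\<close> near \<open>K\<close>, the swap would fix the part of \<open>f x\<close> that
  determines \<open>x\<close> on \<open>K\<close>, although it moves \<open>x\<close> there.\<close>

lemma commuting_has_occurrence:
  assumes f: "f \<in> carrier (Aut_group G A X)"
    and comm: "\<And>\<phi> y. \<phi> \<in> carrier (Aut_group G A X) \<Longrightarrow> y \<in> X \<Longrightarrow> f (\<phi> y) = \<phi> (f y)"
  obtains W where "finite W" "W \<subseteq> carrier G"
    "\<And>x T q. marker G A X K x T q \<Longrightarrow> \<exists>g\<in>W. \<forall>t\<in>T - K. f x (g \<otimes> t) = x t"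
proof -
  obtain f' where hom: "homeomorphic_maps topX topX f f'"
    using Aut_D(2)[OF f] by (auto simp: homeomorphic_map_maps)
  have f': "continuous_map topX topX f'" "\<And>y. y \<in> X \<Longrightarrow> f' (f y) = y"
    using hom unfolding homeomorphic_maps_def topspace_topX by blast+
  have "\<forall>h\<in>K. \<exists>M. finite M \<and> M \<subseteq> carrier G \<and>
    (\<forall>x\<in>X. \<forall>y\<in>X. (\<forall>m\<in>M. x m = y m) \<longrightarrow> f' x h = f' y h)"
    using continuous_local[OF f'(1)] K_carrier by blast
  then obtain M where M: "\<And>h. h \<in> K \<Longrightarrow> finite (M h)" "\<And>h. h \<in> K \<Longrightarrow> M h \<subseteq> carrier G"
    "\<And>h. h \<in> K \<Longrightarrow> \<forall>x\<in>X. \<forall>y\<in>X. (\<forall>m\<in>M h. x m = y m) \<longrightarrow> f' x h = f' y h"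
    by metis
  define N where "N = \<Union>(M ` K)"
  have N: "finite N" "N \<subseteq> carrier G" using M(1,2) finite_K by (auto simp: N_def)
  have iK: "m_inv G ` K \<subseteq> carrier G" using K_carrier by auto
  show ?thesis
  \<comment> \<open>An occurrence whose window meets \<open>N\<close> lies in N K^-1. This set
    depends on \<open>K\<close> and the memory of the inverse of \<open>f\<close> but not on the
    marker, so one bound on the displacement serves all markers.\<close>
  proof (rule that[of "N <#> m_inv G ` K"])
    show "finite (N <#> m_inv G ` K)" using N finite_K by (simp add: finite_set_mult)
    show "N <#> m_inv G ` K \<subseteq> carrier G" using N iK by (simp add: set_mult_closed)
    fix x T q assume "marker G A X K x T q"
    then interpret marker G A X K x T q .
    let ?\<phi> = "restrict (swap UNIV) X"
    show "\<exists>g\<in>N <#> m_inv G ` K. \<forall>t\<in>T - K. f x (g \<otimes> t) = x t"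
    proof (rule ccontr)
      assume none: "\<not> ?thesis"
      have fx: "f x \<in> X" using Aut_D(4)[OF f] x_X by blast
      have "?\<phi> (f x) n = f x n" if n: "n \<in> N" for n
      proof -
        have nG: "n \<in> carrier G" using n N by blast
        have "swap UNIV (f x) n = f x n"
        proof (rule swap_off[OF nG])
          fix g assume g: "g \<in> occurrences (f x)"
          have gG: "g \<in> carrier G" using g by (rule occurrences_carrier)
          show "inv g \<otimes> n \<notin> K"
          proof
            assume "inv g \<otimes> n \<in> K"
            then have "n \<otimes> inv (inv g \<otimes> n) \<in> N <#> m_inv G ` K" using n by (intro set_multI imageI)
            then have "g \<in> N <#> m_inv G ` K" using gG nG by (simp add: group_normalize)
            then show False using none g by (auto simp: occurrences_def)
          qed
        qed
        then show ?thesis using fx by simp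
      qed
      moreover have "f (?\<phi> x) = ?\<phi> (f x)" using comm[OF swap_automorphism x_X] .
      ultimately have "\<forall>n\<in>N. f (?\<phi> x) n = f x n" by simp
      moreover have \<phi>x: "?\<phi> x \<in> X" using swap_X x_X by simp
      ultimately have "f' (f (?\<phi> x)) h = f' (f x) h" if "h \<in> K" for h
        using M(3)[OF that] fx Aut_D(4)[OF f \<phi>x] that unfolding N_def by blast
      then have "?\<phi> x h = x h" if "h \<in> K" for h using f'(2) \<phi>x x_X that by metis
      then show False using swap_moves_marker x_X by auto
    qed
  qed
qed

text \<open>If every g in \<open>W\<close> failed for \<open>x0\<close>, finitely many coordinates
  showing these failures could be built into a marker. Its occurrence in the image at some g in
  \<open>W\<close> contradicts the failure recorded for that g.\<close>

lemma commuting_almost_shift: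
  assumes f: "f \<in> carrier (Aut_group G A X)"
    and comm: "\<And>\<phi> y. \<phi> \<in> carrier (Aut_group G A X) \<Longrightarrow> y \<in> X \<Longrightarrow> f (\<phi> y) = \<phi> (f y)"
  obtains W W' where "finite W" "W \<subseteq> carrier G" "finite W'" "W' \<subseteq> carrier G"
    "\<And>x. x \<in> X \<Longrightarrow> \<exists>g\<in>W. \<forall>h\<in>carrier G - W'. f x h = x (inv g \<otimes> h)"
proof -
  obtain W where W: "finite W" "W \<subseteq> carrier G"
    "\<And>x T q. marker G A X K x T q \<Longrightarrow> \<exists>g\<in>W. \<forall>t\<in>T - K. f x (g \<otimes> t) = x t"
    using commuting_has_occurrence[OF f comm] by blast
  obtain M where M: "finite M" "M \<subseteq> carrier G"
    "\<And>h y z. h \<in> carrier G \<Longrightarrow> y \<in> X \<Longrightarrow> z \<in> X \<Longrightarrow> (\<And>m. m \<in> M \<Longrightarrow> y (h \<otimes> m) = z (h \<otimes> m)) \<Longrightarrow>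
      f y h = f z h"
    using Aut_uniform_memory[OF f] by blast
  \<comment> \<open>Off \<open>W'\<close>, neither the positions read by \<open>f\<close> at h nor
    \<open>inv g \<otimes> h\<close> with g in \<open>W\<close> can lie in \<open>K\<close>, where
    the marker configuration is not controlled.\<close>
  define W' where "W' = (K <#> m_inv G ` M) \<union> (W <#> K)"
  have iM: "m_inv G ` M \<subseteq> carrier G" using M by auto
  show ?thesis
  proof (rule that[OF W(1,2), of W'])
    show "finite W'" using finite_K M W by (simp add: W'_def finite_set_mult)
    show "W' \<subseteq> carrier G" using iM K_carrier W by (simp add: W'_def set_mult_closed)
    fix x0 assume x0: "x0 \<in> X"
    show "\<exists>g\<in>W. \<forall>h\<in>carrier G - W'. f x0 h = x0 (inv g \<otimes> h)"
    proof (rule ccontr)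
      assume "\<not> ?thesis"
      then have "\<forall>g\<in>W. \<exists>h. h \<in> carrier G - W' \<and> f x0 h \<noteq> x0 (inv g \<otimes> h)" by blast
      then obtain h where h: "\<And>g. g \<in> W \<Longrightarrow> h g \<in> carrier G - W'"
        "\<And>g. g \<in> W \<Longrightarrow> f x0 (h g) \<noteq> x0 (inv g \<otimes> h g)" by metis
      define F0 where "F0 = (h ` W <#> M) \<union> (\<lambda>g. inv g \<otimes> h g) ` W"
      have hW: "h ` W \<subseteq> carrier G" using h by blast
      have F0: "finite F0" using W M by (simp add: F0_def finite_set_mult)
      have "inv g \<otimes> h g \<in> carrier G" if "g \<in> W" for g
      proof -
        have "g \<in> carrier G" "h g \<in> carrier G" using that W h by blast+
        then show ?thesis by simp
      qed
      then have F0G: "F0 \<subseteq> carrier G" using set_mult_closed[OF hW M(2)] unfolding F0_def by blast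
      obtain x T q where x: "marker G A X K x T q" "F0 \<subseteq> T" "\<And>h. h \<in> F0 - K \<Longrightarrow> x h = x0 h"
        using marker_locale_exists[OF x0 F0 F0G] by blast
      have xX: "x \<in> X" using x(1) by (rule marker.x_X)
      obtain g where g: "g \<in> W" "\<forall>t\<in>T - K. f x (g \<otimes> t) = x t" using W(3)[OF x(1)] by blast
      have gG: "g \<in> carrier G" using g W by blast
      have hG: "h g \<in> carrier G" "h g \<notin> W'" using h g by blast+
      have "f x (h g) = f x0 (h g)"
      proof (rule M(3)[OF hG(1) xX x0])
        fix m assume m: "m \<in> M"
        then have mG: "m \<in> carrier G" using M by blast
        have "h g \<otimes> m \<in> F0" unfolding F0_def using g m by (intro UnI1 set_multI) auto
        moreover have "h g \<otimes> m \<notin> K"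
        proof
          assume "h g \<otimes> m \<in> K"
          then have "h g \<otimes> m \<otimes> inv m \<in> K <#> m_inv G ` M" using m by (intro set_multI imageI)
          then show False using hG mG by (simp add: W'_def m_assoc)
        qed
        ultimately show "x (h g \<otimes> m) = x0 (h g \<otimes> m)" using x(3) by blast
      qed
      moreover have "inv g \<otimes> h g \<in> F0" using g by (simp add: F0_def)
      moreover have "inv g \<otimes> h g \<notin> K"
      proof
        assume "inv g \<otimes> h g \<in> K"
        then have "g \<otimes> (inv g \<otimes> h g) \<in> W <#> K" using g by (intro set_multI)
        then show False using hG gG by (simp add: W'_def mult_inv_cancel)
      qed
      ultimately have "f x (g \<otimes> (inv g \<otimes> h g)) = x0 (inv g \<otimes> h g)" using g x(2,3) by auto
      then have "f x (h g) = x0 (inv g \<otimes> h g)" using gG hG by (simp add: mult_inv_cancel)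
      then show False using h(2)[OF g(1)] \<open>f x (h g) = f x0 (h g)\<close> by simp
    qed
  qed
qed

text \<open>A configuration that distinguishes any two elements of \<open>W\<close> away from \<open>W'\<close> determines the
  shift used throughout a cylinder, and gluing transports it to all of \<open>X\<close>.\<close>

lemma commuting_eventually_shift:
  assumes f: "f \<in> carrier (Aut_group G A X)"
    and comm: "\<And>\<phi> y. \<phi> \<in> carrier (Aut_group G A X) \<Longrightarrow> y \<in> X \<Longrightarrow> f (\<phi> y) = \<phi> (f y)"
  obtains g V where "g \<in> carrier G" "finite V" "V \<subseteq> carrier G"
    "\<And>y h. y \<in> X \<Longrightarrow> h \<in> carrier G - V \<Longrightarrow> f y h = y (inv g \<otimes> h)"
proof -
  obtain W W' where W: "finite W" "W \<subseteq> carrier G" and W': "finite W'" "W' \<subseteq> carrier G"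
    and fW: "\<And>x. x \<in> X \<Longrightarrow> \<exists>g\<in>W. \<forall>h\<in>carrier G - W'. f x h = x (inv g \<otimes> h)"
    using commuting_almost_shift[OF f comm] by blast
  obtain M where M: "finite M" "M \<subseteq> carrier G"
    "\<And>h y z. h \<in> carrier G \<Longrightarrow> y \<in> X \<Longrightarrow> z \<in> X \<Longrightarrow> (\<And>m. m \<in> M \<Longrightarrow> y (h \<otimes> m) = z (h \<otimes> m)) \<Longrightarrow>
      f y h = f z h"
    using Aut_uniform_memory[OF f] by blast
  have iW: "m_inv G ` W \<subseteq> carrier G" using W by auto
  \<comment> \<open>With h = g k, comparing the shifts by g and g' at h means comparing
    \<open>x0\<close> at k and at (g'^-1 g) k, so quotients from \<open>W\<close> are the
    translations to detect; k off W^-1 W' keeps h out of \<open>W'\<close>.\<close>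
  define \<Gamma> where "\<Gamma> = (m_inv G ` W <#> W) - {\<one>}"
  have "finite \<Gamma>" using W by (simp add: \<Gamma>_def finite_set_mult)
  moreover have "\<Gamma> \<subseteq> carrier G - {\<one>}" using set_mult_closed[OF iW W(2)] unfolding \<Gamma>_def by blast
  moreover have "finite (m_inv G ` W <#> W')" using W W' by (simp add: finite_set_mult)
  ultimately obtain x0 where x0: "x0 \<in> X"
    "\<forall>\<gamma>\<in>\<Gamma>. \<exists>k\<in>carrier G. k \<notin> m_inv G ` W <#> W' \<and> x0 k \<noteq> x0 (\<gamma> \<otimes> k)"
    using moved_points_outside by (meson subsetD)
  have distinct: "\<exists>h. h \<in> carrier G - W' \<and> x0 (inv g \<otimes> h) \<noteq> x0 (inv g' \<otimes> h)"
    if g: "g \<in> W" "g' \<in> W" "g \<noteq> g'" for g g'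
  proof -
    have G: "g \<in> carrier G" "g' \<in> carrier G" using g W by blast+
    have "inv g' \<otimes> g \<noteq> \<one>" using g(3) G by (metis inv_closed inv_equality inv_inv)
    moreover have "inv g' \<otimes> g \<in> m_inv G ` W <#> W" using g by (intro set_multI imageI)
    ultimately obtain k where k: "k \<in> carrier G" "k \<notin> m_inv G ` W <#> W'" "x0 k \<noteq> x0 (inv g' \<otimes> g \<otimes> k)"
      using x0(2) by (auto simp: \<Gamma>_def)
    have "g \<otimes> k \<notin> W'"
    proof
      assume "g \<otimes> k \<in> W'"
      then have "inv g \<otimes> (g \<otimes> k) \<in> m_inv G ` W <#> W'" using g by (intro set_multI imageI)
      then show False using k G by (simp add: inv_mult_cancel)
    qed
    then show ?thesis using k G by (intro exI[of _ "g \<otimes> k"]) (simp add: inv_mult_cancel m_assoc)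
  qed
  obtain g where g: "g \<in> W" "\<forall>h\<in>carrier G - W'. f x0 h = x0 (inv g \<otimes> h)" using fW[OF x0(1)] by blast
  have gG: "g \<in> carrier G" using g W by blast
  have "\<forall>g'\<in>W - {g}. \<exists>h. h \<in> carrier G - W' \<and> x0 (inv g \<otimes> h) \<noteq> x0 (inv g' \<otimes> h)"
    using distinct g by blast
  then obtain d where d: "\<And>g'. g' \<in> W - {g} \<Longrightarrow> d g' \<in> carrier G - W'"
    "\<And>g'. g' \<in> W - {g} \<Longrightarrow> x0 (inv g \<otimes> d g') \<noteq> x0 (inv g' \<otimes> d g')" by metis
  define E where "E = (d ` (W - {g}) <#> M) \<union> (\<lambda>g'. inv g' \<otimes> d g') ` (W - {g})"
  have dG: "d ` (W - {g}) \<subseteq> carrier G" using d by blast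
  have E: "finite E" using W M by (simp add: E_def finite_set_mult)
  have "inv g' \<otimes> d g' \<in> carrier G" if "g' \<in> W - {g}" for g'
  proof -
    have "g' \<in> carrier G" "d g' \<in> carrier G" using that W d by blast+
    then show ?thesis by simp
  qed
  then have EG: "E \<subseteq> carrier G" using set_mult_closed[OF dG M(2)] unfolding E_def by blast
  have cyl: "f x h = x (inv g \<otimes> h)"
    if x: "x \<in> X" "\<And>e. e \<in> E \<Longrightarrow> x e = x0 e" and h: "h \<in> carrier G - W'" for x h
  proof -
    obtain g' where g': "g' \<in> W" "\<forall>h\<in>carrier G - W'. f x h = x (inv g' \<otimes> h)" using fW[OF x(1)] by blast
    have "g' = g"
    proof (rule ccontr)
      assume "g' \<noteq> g"
      then have gd: "g' \<in> W - {g}" using g' by simp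
      have dd: "d g' \<in> carrier G - W'" using d gd by blast
      have "f x (d g') = f x0 (d g')"
      proof (rule M(3))
        fix m assume "m \<in> M"
        then have "d g' \<otimes> m \<in> E" unfolding E_def using gd by (intro UnI1 set_multI) auto
        then show "x (d g' \<otimes> m) = x0 (d g' \<otimes> m)" by (rule x(2))
      qed (use dd x x0 in auto)
      moreover have "f x0 (d g') = x0 (inv g \<otimes> d g')" using g(2) dd by blast
      moreover have "f x (d g') = x (inv g' \<otimes> d g')" using g'(2) dd by blast
      moreover have "inv g' \<otimes> d g' \<in> E" unfolding E_def using gd by blast
      ultimately show False using d(2)[OF gd] x(2) by simp
    qed
    then show ?thesis using g' h by blast
  qed
  \<comment> \<open>Three exceptions: h in \<open>W'\<close>, where \<open>cyl\<close> says nothing;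
    a position read by \<open>f\<close> at h close to \<open>E\<close>; and
    \<open>inv g \<otimes> h\<close> close to \<open>E\<close>. The factor \<open>{\<one>}\<close>
    matches the form of \<open>far_translate\<close>.\<close>
  define V where "V = W' \<union> (E <#> K <#> m_inv G ` M) \<union> ({g} <#> (E <#> K <#> {\<one>}))"
  have iM: "m_inv G ` M \<subseteq> carrier G" using M by auto
  show ?thesis
  proof (rule that[OF gG, of V])
    show "finite V" using W' E finite_K M by (simp add: V_def finite_set_mult)
    show "V \<subseteq> carrier G" using W' EG K_carrier iM gG by (simp add: V_def set_mult_closed)
    fix y h assume y: "y \<in> X" and h: "h \<in> carrier G - V"
    have hG: "h \<in> carrier G" and hV: "h \<notin> W'" "h \<notin> E <#> K <#> m_inv G ` M" "h \<notin> {g} <#> (E <#> K <#> {\<one>})"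
      using h by (auto simp: V_def)
    define D where "D = insert (inv g \<otimes> h) ((\<lambda>m. h \<otimes> m) ` M)"
    have gh: "inv g \<otimes> h \<in> carrier G" using gG hG by simp
    have DG: "D \<subseteq> carrier G" "finite D" using gG hG M by (auto simp: D_def)
    have "\<forall>e\<in>E. \<forall>t\<in>D. inv e \<otimes> t \<notin> K"
    proof (intro ballI)
      fix e t assume e: "e \<in> E" and "t \<in> D"
      then consider "t = inv g \<otimes> h" | m where "m \<in> M" "t = h \<otimes> m" by (auto simp: D_def)
      then show "inv e \<otimes> t \<notin> K"
      proof cases
        case 1
        have "inv g \<otimes> h \<notin> E <#> K <#> {\<one>}"
        proof
          assume "inv g \<otimes> h \<in> E <#> K <#> {\<one>}"
          then have "g \<otimes> (inv g \<otimes> h) \<in> {g} <#> (E <#> K <#> {\<one>})"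
            by (rule set_multI[OF singletonI])
          then show False using hV gG hG by (simp add: mult_inv_cancel)
        qed
        then show ?thesis using far_translate[OF EG, of "{\<one>}" e \<one> "inv g \<otimes> h" K] e gh 1 by simp
      next
        case 2
        then show ?thesis using far_translate[OF EG M(2) e, of m h K] hG hV by simp
      qed
    qed
    from glue[OF E EG DG(2,1) this x0(1) y] obtain x where x: "x \<in> X"
      "\<And>e. e \<in> E \<Longrightarrow> x e = x0 e" "\<And>t. t \<in> D \<Longrightarrow> x t = y t" by blast
    have "f y h = f x h" using M(3)[OF hG y x(1)] x(3) by (simp add: D_def)
    also have "\<dots> = x (inv g \<otimes> h)" using cyl[OF x(1,2)] hG hV by simp
    also have "\<dots> = y (inv g \<otimes> h)" using x(3) by (simp add: D_def)
    finally show "f y h = y (inv g \<otimes> h)" .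
  qed
qed

theorem commuting_is_central_shift:
  assumes f: "f \<in> carrier (Aut_group G A X)"
    and comm: "\<And>\<phi> y. \<phi> \<in> carrier (Aut_group G A X) \<Longrightarrow> y \<in> X \<Longrightarrow> f (\<phi> y) = \<phi> (f y)"
  shows "\<exists>g\<in>carrier G. (\<forall>u\<in>carrier G. g \<otimes> u = u \<otimes> g) \<and> (\<forall>y\<in>X. f y = act g y)"
proof -
  obtain g V where g: "g \<in> carrier G" and V: "finite V" "V \<subseteq> carrier G"
    and fV: "\<And>y h. y \<in> X \<Longrightarrow> h \<in> carrier G - V \<Longrightarrow> f y h = y (inv g \<otimes> h)"
    using commuting_eventually_shift[OF f comm] by blast
  \<comment> \<open>Translating by u moves the coordinate h to u h, off \<open>V\<close>;
    equivariance brings the value back with the shift conjugated by u.\<close>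
  have conj: "f y h = y (inv u \<otimes> (inv g \<otimes> (u \<otimes> h)))"
    if "y \<in> X" "u \<in> carrier G" "h \<in> carrier G" "u \<otimes> h \<notin> V" for y u h
  proof -
    have "f y h = act u (f y) (u \<otimes> h)" using that by (simp add: act_mult)
    also have "\<dots> = f (act u y) (u \<otimes> h)" using Aut_D(3)[OF f] that by simp
    also have "\<dots> = act u y (inv g \<otimes> (u \<otimes> h))" using fV act_X that by simp
    also have "\<dots> = y (inv u \<otimes> (inv g \<otimes> (u \<otimes> h)))" using that g by (simp add: act_apply)
    finally show ?thesis .
  qed
  have central: "g \<otimes> u = u \<otimes> g" if u: "u \<in> carrier G" for u
  proof (rule ccontr)
    assume ne: "g \<otimes> u \<noteq> u \<otimes> g"
    \<comment> \<open>At g k the shift by \<open>g\<close> and its conjugate read y at k and at c k,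
      so a configuration separating these two refutes c being nontrivial. The set \<open>E\<close>
      keeps g k and u g k off \<open>V\<close>.\<close>
    define c where "c = inv u \<otimes> (inv g \<otimes> (u \<otimes> g))"
    have c: "c \<in> carrier G" using u g by (simp add: c_def)
    have "g \<otimes> u \<otimes> c = u \<otimes> g" using u g by (simp add: c_def group_normalize)
    then have "c \<noteq> \<one>" using ne u g by auto
    define E where "E = (\<lambda>v. inv g \<otimes> v) ` V \<union> (\<lambda>v. inv g \<otimes> (inv u \<otimes> v)) ` V"
    have "finite E" using V by (simp add: E_def)
    from moved_point_outside[OF c \<open>c \<noteq> \<one>\<close> this] obtain y k where
      y: "y \<in> X" "k \<in> carrier G" "k \<notin> E" "y k \<noteq> y (c \<otimes> k)" by blast
    have 1: "g \<otimes> k \<notin> V"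
    proof
      assume "g \<otimes> k \<in> V"
      then have "inv g \<otimes> (g \<otimes> k) \<in> E" by (auto simp: E_def)
      then show False using y g by (simp add: inv_mult_cancel)
    qed
    have 2: "u \<otimes> (g \<otimes> k) \<notin> V"
    proof
      assume "u \<otimes> (g \<otimes> k) \<in> V"
      then have "inv g \<otimes> (inv u \<otimes> (u \<otimes> (g \<otimes> k))) \<in> E" by (auto simp: E_def)
      then show False using y g u by (simp add: inv_mult_cancel)
    qed
    have "f y (g \<otimes> k) = y k" using fV[of y "g \<otimes> k"] y g 1 by (simp add: inv_mult_cancel)
    moreover have "f y (g \<otimes> k) = y (c \<otimes> k)"
      using conj[of y u "g \<otimes> k"] y g u 2 by (simp add: c_def m_assoc)
    ultimately show False using y by simp
  qed
  have "f y = act g y" if y: "y \<in> X" for y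
  proof (rule X_eqI)
    show "f y \<in> X" "act g y \<in> X" using Aut_D(4)[OF f] act_X g y by auto
    fix h assume h: "h \<in> carrier G"
    \<comment> \<open>Infinity of the group removes the exceptions: some u moves h out of
      \<open>V\<close>, and centrality turns the conjugated shift back into the original.\<close>
    have "finite ((\<lambda>v. v \<otimes> inv h) ` V)" using V by simp
    then obtain u where u: "u \<in> carrier G" "u \<notin> (\<lambda>v. v \<otimes> inv h) ` V"
      using infinite_G by (meson finite_subset subsetI)
    have "u \<otimes> h \<notin> V"
    proof
      assume "u \<otimes> h \<in> V"
      then have "u \<otimes> h \<otimes> inv h \<in> (\<lambda>v. v \<otimes> inv h) ` V" by blast
      then show False using u h by (simp add: m_assoc)
    qed
    then have "f y h = y (inv u \<otimes> (inv g \<otimes> (u \<otimes> h)))" using conj y u h by blast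
    also have "inv u \<otimes> (inv g \<otimes> (u \<otimes> h)) = inv (g \<otimes> u) \<otimes> (u \<otimes> h)"
      using u g h by (simp add: group_normalize)
    also have "\<dots> = inv g \<otimes> h" using central[OF u(1)] u g h by (simp add: group_normalize)
    finally show "f y h = act g y h" using h by (simp add: act_apply)
  qed
  then show ?thesis using g central by blast
qed

end

section \<open>The center of the automorphism group\<close>

lemma (in group) center_group_is_group: "group (center_group G)"
proof -
  let ?Z = "{z \<in> carrier G. \<forall>g\<in>carrier G. z \<otimes> g = g \<otimes> z}"
  have "subgroup ?Z G"
  proof (rule subgroupI)
    show "inv z \<in> ?Z" if "z \<in> ?Z" for z
    proof -
      have z: "z \<in> carrier G" using that by simp
      have "inv z \<otimes> g = g \<otimes> inv z" if g: "g \<in> carrier G" for g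
      proof -
        have "z \<otimes> (g \<otimes> inv z) = g" using \<open>z \<in> ?Z\<close> g z by (simp add: m_assoc[symmetric]) (simp add: m_assoc)
        then have "inv z \<otimes> g = inv z \<otimes> (z \<otimes> (g \<otimes> inv z))" by simp
        then show ?thesis using g z by (simp add: inv_mult_cancel)
      qed
      then show ?thesis using z by simp
    qed
    show "y \<otimes> z \<in> ?Z" if "y \<in> ?Z" "z \<in> ?Z" for y z
    proof -
      have yz: "y \<in> carrier G" "z \<in> carrier G" using that by simp_all
      have "y \<otimes> z \<otimes> g = g \<otimes> (y \<otimes> z)" if g: "g \<in> carrier G" for g
      proof -
        have "y \<otimes> z \<otimes> g = y \<otimes> (g \<otimes> z)" using \<open>z \<in> ?Z\<close> g yz by (simp add: m_assoc)
        also have "\<dots> = g \<otimes> y \<otimes> z" using \<open>y \<in> ?Z\<close> g yz by (simp add: m_assoc[symmetric])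
        finally show ?thesis using g yz by (simp add: m_assoc)
      qed
      then show ?thesis using yz by simp
    qed
  qed (auto intro: exI[of _ \<one>])
  then show ?thesis unfolding center_group_def by (rule subgroup_imp_group)
qed

lemma center_group_mult: "x \<otimes>\<^bsub>center_group G\<^esub> y = x \<otimes>\<^bsub>G\<^esub> y"
  by (simp add: center_group_def)

text \<open>Closure puts z g and g z where the isomorphism is injective, so commutation transfers in
  both directions.\<close>

lemma center_group_iso:
  assumes closed: "\<And>x y. x \<in> carrier G \<Longrightarrow> y \<in> carrier G \<Longrightarrow> x \<otimes>\<^bsub>G\<^esub> y \<in> carrier G"
    and iso: "G \<cong> H"
  shows "center_group G \<cong> center_group H"
proof -
  obtain \<phi> where "\<phi> \<in> iso G H" using iso by (auto simp: is_iso_def)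
  then have hom: "\<And>x y. x \<in> carrier G \<Longrightarrow> y \<in> carrier G \<Longrightarrow> \<phi> (x \<otimes>\<^bsub>G\<^esub> y) = \<phi> x \<otimes>\<^bsub>H\<^esub> \<phi> y"
    and inj: "inj_on \<phi> (carrier G)" and im: "\<phi> ` carrier G = carrier H"
    by (auto simp: iso_def hom_def bij_betw_def)
  have sub: "carrier (center_group G) \<subseteq> carrier G" "carrier (center_group H) \<subseteq> carrier H"
    by (auto simp: center_group_def)
  have iff: "\<phi> z \<in> carrier (center_group H) \<longleftrightarrow> z \<in> carrier (center_group G)" if z: "z \<in> carrier G" for z
  proof -
    have "z \<otimes>\<^bsub>G\<^esub> g = g \<otimes>\<^bsub>G\<^esub> z \<longleftrightarrow> \<phi> z \<otimes>\<^bsub>H\<^esub> \<phi> g = \<phi> g \<otimes>\<^bsub>H\<^esub> \<phi> z" if g: "g \<in> carrier G" for g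
      using inj_on_eq_iff[OF inj closed[OF z g] closed[OF g z]] hom z g by simp
    then have "(\<forall>h\<in>carrier H. \<phi> z \<otimes>\<^bsub>H\<^esub> h = h \<otimes>\<^bsub>H\<^esub> \<phi> z) \<longleftrightarrow> (\<forall>g\<in>carrier G. z \<otimes>\<^bsub>G\<^esub> g = g \<otimes>\<^bsub>G\<^esub> z)"
      unfolding im[symmetric] by simp
    moreover have "\<phi> z \<in> carrier H" using z im by blast
    ultimately show ?thesis using z by (simp add: center_group_def)
  qed
  have "\<phi> ` carrier (center_group G) = carrier (center_group H)"
  proof
    show "\<phi> ` carrier (center_group G) \<subseteq> carrier (center_group H)" using iff sub(1) by blast
    show "carrier (center_group H) \<subseteq> \<phi> ` carrier (center_group G)"
    proof
      fix w assume w: "w \<in> carrier (center_group H)"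
      then obtain z where "z \<in> carrier G" "w = \<phi> z" using sub(2) im by blast
      then show "w \<in> \<phi> ` carrier (center_group G)" using iff w by blast
    qed
  qed
  moreover have "inj_on \<phi> (carrier (center_group G))"
    using inj sub(1) by (rule inj_on_subset)
  moreover have "\<phi> (y \<otimes>\<^bsub>center_group G\<^esub> z) = \<phi> y \<otimes>\<^bsub>center_group H\<^esub> \<phi> z"
    if "y \<in> carrier (center_group G)" "z \<in> carrier (center_group G)" for y z
    using hom[of y z] that sub(1) by (simp add: center_group_mult subset_iff)
  ultimately have "\<phi> \<in> iso (center_group G) (center_group H)"
    unfolding iso_def hom_def bij_betw_def by blast
  then show ?thesis by (auto simp: is_iso_def)
qed

context group_subshift
begin

lemma Aut_mult:
  "f \<in> carrier (Aut_group G A X) \<Longrightarrow> g \<in> carrier (Aut_group G A X) \<Longrightarrow>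
    f \<otimes>\<^bsub>Aut_group G A X\<^esub> g = compose X f g"
  by (simp add: Aut_group_def BijGroup_def)

lemma Aut_mult_closed:
  assumes f: "f \<in> carrier (Aut_group G A X)" and g: "g \<in> carrier (Aut_group G A X)"
  shows "f \<otimes>\<^bsub>Aut_group G A X\<^esub> g \<in> carrier (Aut_group G A X)"
proof -
  have "homeomorphic_map topX topX (f \<circ> g)"
    by (rule homeomorphic_map_compose[OF Aut_D(2)[OF g] Aut_D(2)[OF f]])
  then have "homeomorphic_map topX topX (compose X f g)"
    by (rule homeomorphic_map_eq) (simp add: topspace_topX compose_def del: topspace_subtopology)
  moreover have "compose X f g (act h y) = act h (compose X f g y)" if "h \<in> carrier G" "y \<in> X" for h y
    using that Aut_D(3,4)[OF g] Aut_D(3)[OF f] act_X by (simp add: compose_def)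
  ultimately have "compose X f g \<in> carrier (Aut_group G A X)"
    using compose_Bij[OF Aut_D(1)[OF f] Aut_D(1)[OF g]] by (simp add: Aut_group_def)
  then show ?thesis using Aut_mult[OF f g] by simp
qed

lemma act_act:
  assumes "g \<in> carrier G" "h \<in> carrier G" "x \<in> X"
  shows "act g (act h x) = act (g \<otimes> h) x"
  using assms by (intro X_eqI act_X) (auto simp: act_apply group_normalize)

lemma act_one: "x \<in> X \<Longrightarrow> act \<one> x = x"
  by (intro X_eqI act_X) (auto simp: act_apply)

text \<open>Centrality of \<open>z\<close> is what makes its shift equivariant; the inverse is the
  shift by \<open>inv z\<close>.\<close>

lemma central_shift_Aut:
  assumes z: "z \<in> carrier G" "\<And>g. g \<in> carrier G \<Longrightarrow> z \<otimes> g = g \<otimes> z"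
  shows "restrict (act z) X \<in> carrier (Aut_group G A X)"
proof -
  let ?f = "\<lambda>g. restrict (act g) X"
  have fX: "?f g y \<in> X" if "g \<in> carrier G" "y \<in> X" for g y using that act_X by simp
  have cont: "continuous_map topX topX (?f g)" if g: "g \<in> carrier G" for g
  proof (rule local_continuous)
    fix h assume h: "h \<in> carrier G"
    show "\<exists>M. finite M \<and> M \<subseteq> carrier G \<and>
      (\<forall>x\<in>X. \<forall>y\<in>X. (\<forall>m\<in>M. x m = y m) \<longrightarrow> ?f g x h = ?f g y h)"
      using g h by (intro exI[of _ "{inv g \<otimes> h}"]) (auto simp: act_apply)
  qed (use fX g in blast)
  have inv1: "?f (inv z) (?f z y) = y" "?f z (?f (inv z) y) = y" if "y \<in> X" for y
    using that z(1) by (simp_all add: act_X act_act act_one)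
  have "homeomorphic_maps topX topX (?f z) (?f (inv z))"
    using cont z(1) inv1 unfolding homeomorphic_maps_def topspace_topX by blast
  then have "homeomorphic_map topX topX (?f z)" by (auto simp only: homeomorphic_map_maps)
  moreover have "bij_betw (?f z) X X"
    by (rule bij_betw_byWitness[where f' = "?f (inv z)"]) (use fX z inv1 in auto)
  moreover have "?f z (act g y) = act g (?f z y)" if "g \<in> carrier G" "y \<in> X" for g y
    using that z by (simp add: act_X act_act)
  ultimately show ?thesis by (simp add: Aut_group_def Bij_def)
qed

end

context si_subshift
begin

text \<open>Sending z to its shift is injective by faithfulness and surjective by
  \<open>commuting_is_central_shift\<close>.\<close>

theorem center_iso_center_Aut: "center_group G \<cong> center_group (Aut_group G A X)"
proof -
  let ?f = "\<lambda>z. restrict (act z) X"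
  have ZG: "z \<in> carrier (center_group G) \<longleftrightarrow> z \<in> carrier G \<and> (\<forall>g\<in>carrier G. z \<otimes> g = g \<otimes> z)" for z
    by (simp add: center_group_def)
  have ZA: "f \<in> carrier (center_group (Aut_group G A X)) \<longleftrightarrow> f \<in> carrier (Aut_group G A X) \<and>
      (\<forall>\<phi>\<in>carrier (Aut_group G A X). compose X f \<phi> = compose X \<phi> f)" for f
    using Aut_mult by (auto simp: center_group_def)
  have into: "?f z \<in> carrier (center_group (Aut_group G A X))" if z: "z \<in> carrier (center_group G)" for z
  proof -
    have zG: "z \<in> carrier G" using z ZG by blast
    have fz: "?f z \<in> carrier (Aut_group G A X)"
      by (rule central_shift_Aut) (use z ZG in auto)
    moreover have "compose X (?f z) \<phi> = compose X \<phi> (?f z)" if "\<phi> \<in> carrier (Aut_group G A X)" for \<phi>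
      using Aut_D(3,4)[OF that] zG by (auto simp: compose_def act_X)
    ultimately show ?thesis by (simp add: ZA)
  qed
  have "?f (y \<otimes> z) = ?f y \<otimes>\<^bsub>Aut_group G A X\<^esub> ?f z"
    if "y \<in> carrier (center_group G)" "z \<in> carrier (center_group G)" for y z
  proof -
    have "y \<in> carrier G" "z \<in> carrier G" using that ZG by blast+
    then have "?f (y \<otimes> z) = compose X (?f y) (?f z)"
      by (auto simp: compose_def act_X act_act)
    moreover have "?f y \<in> carrier (Aut_group G A X)" "?f z \<in> carrier (Aut_group G A X)"
      using into that ZA by blast+
    ultimately show ?thesis using Aut_mult by simp
  qed
  then have "?f \<in> hom (center_group G) (center_group (Aut_group G A X))"
    using into unfolding hom_def center_group_mult by blast
  moreover have "inj_on ?f (carrier (center_group G))"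
  proof (rule inj_onI)
    fix y z assume yz: "y \<in> carrier (center_group G)" "z \<in> carrier (center_group G)" "?f y = ?f z"
    have G: "y \<in> carrier G" "z \<in> carrier G" using yz ZG by blast+
    have "act (inv y \<otimes> z) x = x" if x: "x \<in> X" for x
    proof -
      have "act z x = act y x" using fun_cong[OF yz(3), of x] x by simp
      then show ?thesis using G x act_act[of "inv y" z x] act_act[of "inv y" y x] by (simp add: act_one)
    qed
    then have "inv y \<otimes> z = \<one>" using G by (intro faithful) auto
    then show "y = z" using G by (metis inv_closed inv_equality inv_inv)
  qed
  moreover have "carrier (center_group (Aut_group G A X)) \<subseteq> ?f ` carrier (center_group G)"
  proof
    fix f assume f: "f \<in> carrier (center_group (Aut_group G A X))"
    then have fA: "f \<in> carrier (Aut_group G A X)" using ZA by blast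
    have comm: "f (\<phi> y) = \<phi> (f y)" if "\<phi> \<in> carrier (Aut_group G A X)" "y \<in> X" for \<phi> y
    proof -
      have "compose X f \<phi> = compose X \<phi> f" using f that ZA by blast
      from fun_cong[OF this, of y] show ?thesis using that by (simp add: compose_def)
    qed
    obtain g where g: "g \<in> carrier G" "\<forall>u\<in>carrier G. g \<otimes> u = u \<otimes> g" "\<forall>y\<in>X. f y = act g y"
      using commuting_is_central_shift[OF fA comm] by blast
    have "f \<in> extensional X" using Aut_D(1)[OF fA] by (rule Bij_imp_extensional)
    then have "f = ?f g" using g(3) by (intro extensionalityI[of _ X]) auto
    then show "f \<in> ?f ` carrier (center_group G)" using g ZG by blast
  qed
  ultimately have "?f \<in> iso (center_group G) (center_group (Aut_group G A X))"
    using into by (auto simp: iso_def bij_betw_def)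
  then show ?thesis by (auto simp: is_iso_def)
qed

end

section \<open>From the definitions to the locale, and the main isomorphism\<close>

lemma si_subshift_exists:
  assumes "group G" "finite A" "infinite (carrier G)"
    and "subshift G A X" "faithful_subshift G X" "strongly_irreducible G X"
  shows "\<exists>K. si_subshift G A X K"
proof -
  interpret group_subshift G A X
    by (intro group_subshift.intro group_subshift_axioms.intro assms)
  obtain K0 where K0: "finite K0" "K0 \<subseteq> carrier G"
    and irr: "\<forall>S T. finite S \<and> S \<subseteq> carrier G \<and> finite T \<and> T \<subseteq> carrier G \<and>
      (S <#>\<^bsub>G\<^esub> K0) \<inter> T = {} \<longrightarrow>
      (\<forall>p\<in>patterns S X. \<forall>q\<in>patterns T X. \<exists>x\<in>X. restrict x S = p \<and> restrict x T = q)"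
    using assms(6) unfolding strongly_irreducible_def by (elim exE conjE) (rule that)
  \<comment> \<open>Adding \<open>\<one>\<close> and inverses only strengthens the separation that
    gluing demands, so the given irreducibility still applies.\<close>
  define K where "K = insert \<one>\<^bsub>G\<^esub> (K0 \<union> m_inv G ` K0)"
  have "si_subshift_axioms G X K"
  proof
    show "infinite (carrier G)" by fact
    show "g = \<one>\<^bsub>G\<^esub>" if "g \<in> carrier G" "\<forall>x\<in>X. act g x = x" for g
      using assms(5) that by (auto simp: faithful_subshift_def)
    show "finite K" "K \<subseteq> carrier G" "\<one>\<^bsub>G\<^esub> \<in> K" using K0 by (auto simp: K_def)
    show "inv\<^bsub>G\<^esub> k \<in> K" if "k \<in> K" for k
      using that K0 by (auto simp: K_def)
    fix S T y z
    assume ST: "finite S" "S \<subseteq> carrier G" "finite T" "T \<subseteq> carrier G"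
      and far: "\<forall>s\<in>S. \<forall>t\<in>T. inv\<^bsub>G\<^esub> s \<otimes>\<^bsub>G\<^esub> t \<notin> K" and yz: "y \<in> X" "z \<in> X"
    have "(S <#>\<^bsub>G\<^esub> K0) \<inter> T = {}"
    proof (rule ccontr)
      assume "(S <#>\<^bsub>G\<^esub> K0) \<inter> T \<noteq> {}"
      then obtain s k where sk: "s \<in> S" "k \<in> K0" "s \<otimes>\<^bsub>G\<^esub> k \<in> T" by (auto simp: set_mult_def)
      then have "s \<in> carrier G" "k \<in> carrier G" using ST K0 by blast+
      then have "inv\<^bsub>G\<^esub> s \<otimes>\<^bsub>G\<^esub> (s \<otimes>\<^bsub>G\<^esub> k) = k" by (rule inv_mult_cancel)
      moreover have "inv\<^bsub>G\<^esub> s \<otimes>\<^bsub>G\<^esub> (s \<otimes>\<^bsub>G\<^esub> k) \<notin> K" using far sk by blast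
      ultimately show False using sk by (simp add: K_def)
    qed
    with irr ST have "\<forall>p\<in>patterns S X. \<forall>q\<in>patterns T X. \<exists>x\<in>X. restrict x S = p \<and> restrict x T = q"
      by simp
    moreover have "restrict y S \<in> patterns S X" "restrict z T \<in> patterns T X"
      using yz by (simp_all add: patterns_def)
    ultimately obtain x where x: "x \<in> X" "restrict x S = restrict y S" "restrict x T = restrict z T"
      by blast
    have "x s = y s" if "s \<in> S" for s using fun_cong[OF x(2), of s] that by simp
    moreover have "x t = z t" if "t \<in> T" for t using fun_cong[OF x(3), of t] that by simp
    ultimately show "\<exists>x\<in>X. (\<forall>s\<in>S. x s = y s) \<and> (\<forall>t\<in>T. x t = z t)" using x(1) by blast
  qed
  then show ?thesis
    using group_subshift_axioms by (auto simp: si_subshift_def)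
qed

lemma center_iso_of_Aut_iso:
  assumes "group G" "group H" "infinite (carrier G)" "infinite (carrier H)" "finite A" "finite B"
    and "subshift G A X" "faithful_subshift G X" "strongly_irreducible G X"
    and "subshift H B Y" "faithful_subshift H Y" "strongly_irreducible H Y"
    and iso: "Aut_group G A X \<cong> Aut_group H B Y"
  shows "center_group G \<cong> center_group H"
proof -
  obtain K where "si_subshift G A X K" using si_subshift_exists assms by blast
  then interpret X: si_subshift G A X K .
  obtain K' where "si_subshift H B Y K'" using si_subshift_exists assms by blast
  then interpret Y: si_subshift H B Y K' .
  have "center_group G \<cong> center_group (Aut_group G A X)" by (rule X.center_iso_center_Aut)
  also have "center_group (Aut_group G A X) \<cong> center_group (Aut_group H B Y)"
    by (rule center_group_iso[OF X.Aut_mult_closed iso])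
  \<comment> \<open>Symmetry is taken from the side of the center of \<open>H\<close>, which
    \<open>center_group_is_group\<close> shows to be a group.\<close>
  also have "center_group (Aut_group H B Y) \<cong> center_group H"
    using Y.center_group_is_group Y.center_iso_center_Aut by (rule group.iso_sym)
  finally show ?thesis .
qed

section \<open>Full shifts\<close>

lemma subshift_full_shift:
  assumes "group G"
  shows "subshift G A (full_shift G A)"
proof -
  interpret group G by fact
  have "closedin (prodiscrete G A) (full_shift G A)"
    using closedin_topspace[of "prodiscrete G A"] by (simp add: topspace_prodiscrete)
  moreover have "shift_action G g x \<in> full_shift G A" if "g \<in> carrier G" "x \<in> full_shift G A" for g x
    using that by (auto simp: full_shift_def shift_action_def)
  ultimately show ?thesis by (auto simp: subshift_def)
qed

lemma faithful_full_shift: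
  assumes "group G" "a \<in> A" "b \<in> A" "a \<noteq> b"
  shows "faithful_subshift G (full_shift G A)"
  unfolding faithful_subshift_def
proof (intro ballI impI)
  interpret group G by fact
  fix g assume g: "g \<in> carrier G" and fix_g: "\<forall>x\<in>full_shift G A. shift_action G g x = x"
  \<comment> \<open>A configuration with a single \<open>a\<close>, placed at \<open>\<one>\<close>,
    is fixed only by the trivial translation.\<close>
  define x where "x = (\<lambda>h\<in>carrier G. if h = \<one>\<^bsub>G\<^esub> then a else b)"
  have "x \<in> full_shift G A" using assms by (simp add: x_def full_shift_def)
  then have "shift_action G g x \<one>\<^bsub>G\<^esub> = x \<one>\<^bsub>G\<^esub>" using fix_g by simp
  then have "x (inv\<^bsub>G\<^esub> g) = a" using g by (simp add: shift_action_def x_def)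
  then have "inv\<^bsub>G\<^esub> g = \<one>\<^bsub>G\<^esub>" using g \<open>a \<noteq> b\<close> by (auto simp: x_def split: if_splits)
  then show "g = \<one>\<^bsub>G\<^esub>" using g inv_eq_1_iff by blast
qed

lemma strongly_irreducible_full_shift:
  assumes "group G"
  shows "strongly_irreducible G (full_shift G A)"
  unfolding strongly_irreducible_def
proof (intro exI[of _ "{\<one>\<^bsub>G\<^esub>}"] conjI allI impI ballI)
  interpret group G by fact
  show "{\<one>\<^bsub>G\<^esub>} \<subseteq> carrier G" by simp
  fix S T p q
  assume ST: "finite S \<and> S \<subseteq> carrier G \<and> finite T \<and> T \<subseteq> carrier G \<and> (S <#>\<^bsub>G\<^esub> {\<one>\<^bsub>G\<^esub>}) \<inter> T = {}"
    and p: "p \<in> patterns S (full_shift G A)" and q: "q \<in> patterns T (full_shift G A)"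
  have disj: "s \<notin> T" if "s \<in> S" for s
  proof -
    have "s \<otimes>\<^bsub>G\<^esub> \<one>\<^bsub>G\<^esub> \<in> S <#>\<^bsub>G\<^esub> {\<one>\<^bsub>G\<^esub>}" using that by (intro set_multI) auto
    moreover have "s \<in> carrier G" using that ST by blast
    ultimately show ?thesis using ST by auto
  qed
  obtain y z where y: "y \<in> full_shift G A" "p = restrict y S" and z: "z \<in> full_shift G A" "q = restrict z T"
    using p q by (auto simp: patterns_def)
  define x where "x = override_on z y S"
  have "x \<in> full_shift G A"
    using y(1) z(1) ST unfolding x_def full_shift_def
    by (intro PiE_I) (auto simp: override_on_def PiE_def extensional_def)
  moreover have "restrict x S = p" using y by (auto simp: x_def)
  moreover have "restrict x T = q" using z disj by (auto simp: x_def override_on_def)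
  ultimately show "\<exists>x\<in>full_shift G A. restrict x S = p \<and> restrict x T = q" by blast
qed simp

theorem corollary5p3:
  fixes G :: "('g, 'r) monoid_scheme" and H :: "('h, 's) monoid_scheme"
    and A :: "'a set" and B :: "'b set"
  assumes "group G" and "group H"
    and "infinite (carrier G)" and "infinite (carrier H)"
    and "finite A" and "finite B"
  shows "(\<forall>X Y. subshift G A X \<and> faithful_subshift G X \<and> strongly_irreducible G X \<and>
                subshift H B Y \<and> faithful_subshift H Y \<and> strongly_irreducible H Y \<and>
                Aut_group G A X \<cong> Aut_group H B Y \<longrightarrow>
                center_group G \<cong> center_group H) \<and>
         (min (card A) (card B) \<ge> 2 \<and>
          Aut_group G A (full_shift G A) \<cong> Aut_group H B (full_shift H B) \<longrightarrow>
          center_group G \<cong> center_group H)"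
proof (intro conjI allI impI)
  show "center_group G \<cong> center_group H"
    if "subshift G A X \<and> faithful_subshift G X \<and> strongly_irreducible G X \<and>
        subshift H B Y \<and> faithful_subshift H Y \<and> strongly_irreducible H Y \<and>
        Aut_group G A X \<cong> Aut_group H B Y" for X Y
    using that by (intro center_iso_of_Aut_iso[OF assms, of X Y]) auto
next
  assume full: "min (card A) (card B) \<ge> 2 \<and>
    Aut_group G A (full_shift G A) \<cong> Aut_group H B (full_shift H B)"
  obtain a a' where a: "a \<in> A" "a' \<in> A" "a \<noteq> a'"
    using full by (auto simp: card_le_Suc_iff numeral_2_eq_2)
  obtain b b' where b: "b \<in> B" "b' \<in> B" "b \<noteq> b'"
    using full by (auto simp: card_le_Suc_iff numeral_2_eq_2)
  show "center_group G \<cong> center_group H"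
    by (rule center_iso_of_Aut_iso[OF assms])
      (use full assms a b in \<open>auto intro: subshift_full_shift strongly_irreducible_full_shift faithful_full_shift\<close>)
qed

end
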